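(* Let $n\ge1$ and $w\in W^{\mathsf{BC}}_n$. Then (a) $\displaystyle\mathfrak{G}^{\mathsf{B}}_w(x_i \mapsto q^{i-1}) = \sum_{a \in \mathsf{Hecke}^\pm_B(w)} \frac{\beta^{\ell(a) - \ell(w)}}{(q-1)(q^{2}-1)\cdots (q^{\ell(a)}-1)} q^{ \Sigma_{\mathsf{BC}}(a) + \operatorname{comaj}_{\mathsf{BC}}(a)}$; (b) $\displaystyle\mathfrak{G}^{\mathsf{C}}_w(x_i \mapsto q^{i-1}) = \sum_{a \in \mathsf{Hecke}^\pm_C(w)} \frac{\beta^{\ell(a) - \ell(w)}}{(q-1)(q^{2}-1)\cdots (q^{\ell(a)}-1)} q^{ \Sigma_{\mathsf{BC}}(a) + \operatorname{comaj}_{\mathsf{BC}}(a)}$, where in both parts each summand on the right is expanded as a Laurent series in $q^{-1}$.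
   Context: Let $x_i$ ($i\in\mathbb{Z}$) be commuting indeterminates and $\beta$ an indeterminate. For $0<i<n$ let $t_i=t_{-i}=(i,i+1)(-i,-i-1)$, $t_0=(-1,1)$; $W^{\mathsf{BC}}_n=\langle t_0,\dots,t_{n-1}\rangle$ is the Coxeter group of permutations $w$ of $\mathbb{Z}$ with $w(i)=i$ for $|i|>n$ and $w(-i)=-w(i)$, with Coxeter length $\ell$. Let $-0$ be a formal symbol with $-1<-0<0<1$, and $t_{-0}=t_0$. Consider the id-Coxeter algebra over $\mathbb{Z}[\beta]$ with basis $\pi_v$ ($v\in W^{\mathsf{BC}}_n$), relations $\pi_u\pi_v=\pi_{uv}$ if $\ell(uv)=\ell(u)+\ell(v)$ and $\pi_s^2=\beta\pi_s$ for simple $s$; write $\pi_a=\pi_{t_a}$ for a letter $a$. $\mathsf{Hecke}^\pm_B(w)$ (resp. $\mathsf{Hecke}^\pm_C(w)$) is the set of words $a_1\cdots a_N$ with letters in $\{-n+1,\dots,-1,0,1,\dots,n-1\}$ (resp. in $\{-n+1<\dots<-1<-0<0<1<\dots<n-1\}$) such that $\pi_{a_1}\cdots\pi_{a_N}=\beta^{N-\ell(w)}\pi_w$. For a word $a=a_1\cdots a_p$ in the ordered alphabet, a bounded compatible sequence is a weakly increasing integer sequence $\mathbf{i}=(i_1\le\dots\le i_p)$ with $i_j<i_{j+1}$ whenever $a_j\le a_{j+1}$ and $i_j\le a_j$ whenever $0<i_j$; $\mathsf{Compatible}(a)$ is the set of these, $\ell(\mathbf{i})=\ell(a)=p$, $x_{\mathbf{i}}=x_{i_1}\cdots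 x_{i_p}$. Define $\mathfrak{G}^{\mathsf{B}}_w=\sum_{a\in\mathsf{Hecke}^\pm_B(w)}\sum_{\mathbf{i}\in\mathsf{Compatible}(a)}\beta^{\ell(\mathbf{i})-\ell(w)}x_{\mathbf{i}}$ and $\mathfrak{G}^{\mathsf{C}}_w$ likewise with $\mathsf{Hecke}^\pm_C(w)$. $F(x_i\mapsto q^{i-1})$ means setting $x_i=q^{i-1}$ for all $i<n$. For a word $a$, let $I(a)$ be the set of indices $i$ with $a_i\in\{1,\dots,n-1\}$, $\Sigma_{\mathsf{BC}}(a)=\sum_{i\in I(a)}a_i$, and $\operatorname{comaj}_{\mathsf{BC}}(a)=\sum_{i:\,a_i\prec a_{i+1}}i$ where $\prec$ is the order $-0\prec0\prec-1\prec1\prec-2\prec2\prec\cdots$. *)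

theory Defs
  imports
    "HOL-Analysis.Infinite_Sum"
    "HOL-Combinatorics.Transposition"
    "HOL-Library.Multiset"
    "HOL-Computational_Algebra.Computational_Algebra"
begin

section \<open>The hyperoctahedral group\<close>

definition W_BC :: "nat \<Rightarrow> (int \<Rightarrow> int) set" where
  "W_BC n = {w. bij w \<and> (\<forall>i. \<bar>i\<bar> > int n \<longrightarrow> w i = i) \<and> (\<forall>i. w (- i) = - w i)}"

definition t_BC :: "nat \<Rightarrow> int \<Rightarrow> int" where
  "t_BC i = (if i = 0 then Transposition.transpose (- 1) 1
             else Transposition.transpose (int i) (int i + 1)
               \<circ> Transposition.transpose (- int i) (- int i - 1))"

text \<open>Coxeter length with respect to the generators \<open>t_BC 0, \<dots>, t_BC (n - 1)\<close>.\<close>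

definition length_BC :: "nat \<Rightarrow> (int \<Rightarrow> int) \<Rightarrow> nat" where
  "length_BC n w =
     (LEAST N. \<exists>js. length js = N \<and> set js \<subseteq> {..<n} \<and> w = foldr (\<lambda>j v. t_BC j \<circ> v) js id)"

section \<open>The id-Coxeter algebra\<close>

abbreviation \<beta> :: "int poly" where
  "\<beta> \<equiv> [:0, 1:]"

text \<open>
  The type \<open>'h\<close> is a unital associative algebra over the polynomial ring in \<open>\<beta>\<close> that
  contains the id-Coxeter algebra, which is the subalgebra spanned by its basis
  \<open>(\<pi> v)\<close>, \<open>v \<in> W_BC n\<close>. It is not required to be all of \<open>'h\<close> because its rank depends on \<open>n\<close>.
  Values of \<open>\<pi>\<close> outside \<open>W_BC n\<close> are irrelevant.
\<close>

locale id_coxeter_algebra = module smul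
  for smul :: "int poly \<Rightarrow> 'h::ring_1 \<Rightarrow> 'h" +
  fixes n :: nat and \<pi> :: "(int \<Rightarrow> int) \<Rightarrow> 'h"
  assumes smul_mult_left: "smul c x * y = smul c (x * y)"
    and smul_mult_right: "x * smul c y = smul c (x * y)"
    and basis_inj: "inj_on \<pi> (W_BC n)"
    and basis_independent: "independent (\<pi> ` W_BC n)"
    and basis_id: "\<pi> id = 1"
    and basis_mult: "\<lbrakk>u \<in> W_BC n; v \<in> W_BC n;
        length_BC n (u \<circ> v) = length_BC n u + length_BC n v\<rbrakk> \<Longrightarrow> \<pi> u * \<pi> v = \<pi> (u \<circ> v)"
    and basis_simple_square: "i < n \<Longrightarrow> \<pi> (t_BC i) * \<pi> (t_BC i) = smul \<beta> (\<pi> (t_BC i))"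

section \<open>Letters\<close>

text \<open>
  \<open>Pos k\<close> is the letter \<open>k\<close> and \<open>Neg k\<close> is the letter \<open>-k\<close>. In particular \<open>Neg 0\<close> is the
  formal symbol \<open>-0\<close>, which occurs only in the alphabet of type C.
\<close>

datatype letter = Neg nat | Pos nat

fun absv :: "letter \<Rightarrow> nat" where
  "absv (Neg k) = k"
| "absv (Pos k) = k"

fun val :: "letter \<Rightarrow> int" where
  "val (Neg k) = - int k"
| "val (Pos k) = int k"

text \<open>The order \<open>\<dots> < -2 < -1 < -0 < 0 < 1 < 2 < \<dots>\<close>.\<close>

fun rank_std :: "letter \<Rightarrow> int" where
  "rank_std (Neg k) = - int k - 1"
| "rank_std (Pos k) = int k"

definition letter_le :: "letter \<Rightarrow> letter \<Rightarrow> bool" where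
  "letter_le a b \<longleftrightarrow> rank_std a \<le> rank_std b"

text \<open>The order \<open>-0 \<prec> 0 \<prec> -1 \<prec> 1 \<prec> -2 \<prec> 2 \<prec> \<dots>\<close>.\<close>

fun rank_prec :: "letter \<Rightarrow> nat" where
  "rank_prec (Neg k) = 2 * k"
| "rank_prec (Pos k) = 2 * k + 1"

definition letter_prec :: "letter \<Rightarrow> letter \<Rightarrow> bool" where
  "letter_prec a b \<longleftrightarrow> rank_prec a < rank_prec b"

definition alphabet_C :: "nat \<Rightarrow> letter set" where
  "alphabet_C n = {a. absv a < n}"

definition alphabet_B :: "nat \<Rightarrow> letter set" where
  "alphabet_B n = alphabet_C n - {Neg 0}"

section \<open>Hecke words and compatible sequences\<close>

text \<open>
  The conjunct \<open>length_BC n w \<le> length a\<close> makes the exponent a genuine (non-truncated) difference.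
\<close>

definition hecke_words ::
  "letter set \<Rightarrow> (int poly \<Rightarrow> 'h::ring_1 \<Rightarrow> 'h) \<Rightarrow> nat \<Rightarrow> ((int \<Rightarrow> int) \<Rightarrow> 'h) \<Rightarrow> (int \<Rightarrow> int) \<Rightarrow> letter list set"
  where
  "hecke_words A smul n \<pi> w =
     {a. set a \<subseteq> A \<and> length_BC n w \<le> length a \<and>
         prod_list (map (\<lambda>c. \<pi> (t_BC (absv c))) a) = smul (\<beta> ^ (length a - length_BC n w)) (\<pi> w)}"

definition hecke_B ::
  "(int poly \<Rightarrow> 'h::ring_1 \<Rightarrow> 'h) \<Rightarrow> nat \<Rightarrow> ((int \<Rightarrow> int) \<Rightarrow> 'h) \<Rightarrow> (int \<Rightarrow> int) \<Rightarrow> letter list set" where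
  "hecke_B smul n \<pi> w = hecke_words (alphabet_B n) smul n \<pi> w"

definition hecke_C ::
  "(int poly \<Rightarrow> 'h::ring_1 \<Rightarrow> 'h) \<Rightarrow> nat \<Rightarrow> ((int \<Rightarrow> int) \<Rightarrow> 'h) \<Rightarrow> (int \<Rightarrow> int) \<Rightarrow> letter list set" where
  "hecke_C smul n \<pi> w = hecke_words (alphabet_C n) smul n \<pi> w"

definition compatible :: "letter list \<Rightarrow> int list set" where
  "compatible a =
     {s. length s = length a \<and> sorted s \<and>
         (\<forall>j. Suc j < length a \<longrightarrow> letter_le (a ! j) (a ! Suc j) \<longrightarrow> s ! j < s ! Suc j) \<and>
         (\<forall>j < length a. 0 < s ! j \<longrightarrow> s ! j \<le> val (a ! j))}"

section \<open>Grothendieck series\<close>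

text \<open>
  A formal power series in the commuting variables \<open>x i\<close>, \<open>i\<close> an integer, is given by its
  coefficients: the multiset \<open>M\<close> stands for the monomial \<open>\<Prod>i\<in>#M. x i\<close>.
\<close>

type_synonym xseries = "int multiset \<Rightarrow> int poly"

definition grothendieck :: "letter list set \<Rightarrow> nat \<Rightarrow> xseries" where
  "grothendieck H l M =
     (\<Sum>(a, s) \<in> {(a, s). a \<in> H \<and> s \<in> compatible a \<and> mset s = M}. \<beta> ^ (length s - l))"

definition grothendieck_B ::
  "(int poly \<Rightarrow> 'h::ring_1 \<Rightarrow> 'h) \<Rightarrow> nat \<Rightarrow> ((int \<Rightarrow> int) \<Rightarrow> 'h) \<Rightarrow> (int \<Rightarrow> int) \<Rightarrow> xseries" where
  "grothendieck_B smul n \<pi> w = grothendieck (hecke_B smul n \<pi> w) (length_BC n w)"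

definition grothendieck_C ::
  "(int poly \<Rightarrow> 'h::ring_1 \<Rightarrow> 'h) \<Rightarrow> nat \<Rightarrow> ((int \<Rightarrow> int) \<Rightarrow> 'h) \<Rightarrow> (int \<Rightarrow> int) \<Rightarrow> xseries" where
  "grothendieck_C smul n \<pi> w = grothendieck (hecke_C smul n \<pi> w) (length_BC n w)"

lemma finite_alphabet_C: "finite (alphabet_C n)"
proof -
  have "alphabet_C n \<subseteq> Neg ` {..<n} \<union> Pos ` {..<n}"
  proof
    fix a assume "a \<in> alphabet_C n"
    then show "a \<in> Neg ` {..<n} \<union> Pos ` {..<n}"
      by (cases a) (auto simp: alphabet_C_def)
  qed
  then show ?thesis
    by (rule finite_subset) simp
qed

text \<open>The sums defining the coefficients are finite.\<close>

lemma finite_grothendieck_terms: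
  assumes "\<And>a. a \<in> H \<Longrightarrow> set a \<subseteq> alphabet_C n"
  shows "finite {(a, s). a \<in> H \<and> s \<in> compatible a \<and> mset s = M}"
proof (rule finite_subset)
  show "{(a, s). a \<in> H \<and> s \<in> compatible a \<and> mset s = M}
      \<subseteq> {a. set a \<subseteq> alphabet_C n \<and> length a = size M} \<times> {sorted_list_of_multiset M}"
  proof
    fix p assume "p \<in> {(a, s). a \<in> H \<and> s \<in> compatible a \<and> mset s = M}"
    then obtain a s where p: "p = (a, s)" "a \<in> H" "s \<in> compatible a" "mset s = M"
      by auto
    have "sorted_list_of_multiset M = s"
      using p by (auto simp: compatible_def sorted_sort_id)
    moreover have "length a = size M"
      using p by (auto simp: compatible_def)
    ultimately show "p \<in> {a. set a \<subseteq> alphabet_C n \<and> length a = size M}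
        \<times> {sorted_list_of_multiset M}"
      using p assms by auto
  qed
  show "finite ({a. set a \<subseteq> alphabet_C n \<and> length a = size M} \<times> {sorted_list_of_multiset M})"
    using finite_lists_length_eq[OF finite_alphabet_C] by simp
qed

text \<open>Only variables \<open>x i\<close> with \<open>i < n\<close> occur.\<close>

lemma grothendieck_variables:
  assumes "\<And>a. a \<in> H \<Longrightarrow> set a \<subseteq> alphabet_C n" and "n \<ge> 1"
    and "i \<in># M" "i \<ge> int n"
  shows "grothendieck H l M = 0"
proof -
  have "mset s \<noteq> M" if "a \<in> H" "s \<in> compatible a" for a s
  proof
    assume "mset s = M"
    then obtain j where j: "j < length s" "s ! j = i"
      using assms(3) by (metis in_set_conv_nth set_mset_mset)
    have "s ! j \<le> val (a ! j)" and len: "length a = length s"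
      using that(2) j assms(2,4) by (auto simp: compatible_def)
    moreover have "a ! j \<in> alphabet_C n"
      using assms(1)[OF that(1)] j len by (metis nth_mem subsetD)
    then have "val (a ! j) < int n"
      by (cases "a ! j") (use assms(2) in \<open>auto simp: alphabet_C_def\<close>)
    ultimately show False
      using j assms(4) by simp
  qed
  then have "{(a, s). a \<in> H \<and> s \<in> compatible a \<and> mset s = M} = {}"
    by auto
  then show ?thesis
    unfolding grothendieck_def by (simp only: sum.empty)
qed

section \<open>Laurent series in the inverse of q\<close>

text \<open>
  The variable \<open>fls_X\<close> of the Laurent series ring plays the role of the inverse of \<open>q\<close>. Coefficients
  are polynomials in \<open>\<beta>\<close>, embedded into their fraction field, so that the Laurent series form a
  field in which division is expansion in powers of the inverse of \<open>q\<close>. Infinite sums are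
  taken in the \<open>fls_X\<close>-adic topology.
\<close>

type_synonym qseries = "int poly fract fls"

definition qvar :: qseries where
  "qvar = inverse fls_X"

definition coef :: "int poly \<Rightarrow> qseries" where
  "coef p = fls_const (to_fract p)"

definition specialization_term :: "xseries \<Rightarrow> (int \<Rightarrow> qseries) \<Rightarrow> int multiset \<Rightarrow> qseries" where
  "specialization_term F f M = coef (F M) * (\<Prod>i\<in>#M. f i)"

definition specializable :: "xseries \<Rightarrow> (int \<Rightarrow> qseries) \<Rightarrow> bool" where
  "specializable F f \<longleftrightarrow> specialization_term F f summable_on UNIV"

definition specialize :: "xseries \<Rightarrow> (int \<Rightarrow> qseries) \<Rightarrow> qseries" where
  "specialize F f = (\<Sum>\<^sub>\<infinity>M. specialization_term F f M)"

section \<open>Word statistics\<close>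

text \<open>
  Words are 0-indexed lists, whereas the positions \<open>i\<close> summed in \<open>comaj_BC\<close> are 1-based.
\<close>

definition Sigma_BC :: "letter list \<Rightarrow> int" where
  "Sigma_BC a = (\<Sum>j \<in> {j. j < length a \<and> val (a ! j) \<ge> 1}. val (a ! j))"

definition comaj_BC :: "letter list \<Rightarrow> nat" where
  "comaj_BC a = (\<Sum>i \<in> {i. 1 \<le> i \<and> i < length a \<and> letter_prec (a ! (i - 1)) (a ! i)}. i)"

end

theory Submission
  imports Defs
begin

text \<open>
  Put \<open>X = 1 / q\<close> and \<open>h\<^sub>j(e) = 1 + X\<^sup>e \<pi>\<^sub>j\<close>, where \<open>\<pi>\<^sub>j\<close> is the basis element of the generator \<open>t_BC j\<close>.
  These elements satisfy a Yang--Baxter relation. Summing over compatible sequences, respectively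
  expanding \<open>1 / ((q - 1) \<dots> (q\<^sup>N - 1))\<close> by the theory of P-partitions, turns the two sides into the coefficients
  of the infinite products \<open>\<dots> B(2) B(1) T(0)\<close> and \<open>\<dots> C(2) C(1)\<close>, where

  \<open>B(e) = h\<^sub>n\<^sub>-\<^sub>1(e) \<dots> h\<^sub>1(e) z(e) h\<^sub>1(e) \<dots> h\<^sub>n\<^sub>-\<^sub>1(e)\<close>,
  \<open>C(e) = z(e) h\<^sub>1(e) h\<^sub>1(e - 1) h\<^sub>2(e) h\<^sub>2(e - 2) \<dots>\<close>,
  \<open>T(e) = \<Prod>i. h\<^sub>n\<^sub>-\<^sub>1(e - i + 1) \<dots> h\<^sub>i(e - i + 1)\<close>,

  and \<open>z(e)\<close> is \<open>h\<^sub>0(e)\<close> in type B and \<open>h\<^sub>0(e)\<^sup>2\<close> in type C. The Yang--Baxter relation gives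
  \<open>B(e) T(e - 1) = T(e) C(e)\<close>, hence \<open>B(m) \<dots> B(1) T(0) = T(m) C(m) \<dots> C(1)\<close>, and \<open>T(m)\<close> tends to 1.
\<close>

section \<open>Yang--Baxter products\<close>

lemma prod_list_commute:
  fixes x :: "'r::monoid_mult"
  assumes "\<And>y. y \<in> set ys \<Longrightarrow> x * y = y * x"
  shows "x * prod_list ys = prod_list ys * x"
  using assms
proof (induction ys)
  case (Cons y ys)
  have "x * (y * prod_list ys) = y * (x * prod_list ys)"
    using Cons.prems[of y] by (simp add: mult.assoc[symmetric])
  then show ?case
    using Cons by (simp add: mult.assoc)
qed simp

text \<open>In \<open>h_braid\<close> the two middle factors act like one factor whose argument is a
  formal sum of \<open>x\<close> and \<open>y\<close>; keeping them apart lets all arguments stay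
  integer exponents. Index 0 is left out because \<open>t_BC 0\<close> and \<open>t_BC 1\<close>
  obey a braid relation of length four.\<close>

locale yang_baxter =
  fixes h :: "nat \<Rightarrow> int \<Rightarrow> 'r::monoid_mult" and n :: nat
  assumes h_far: "j + 2 \<le> k \<Longrightarrow> h j x * h k y = h k y * h j x"
    and h_braid: "1 \<le> k \<Longrightarrow>
      h k x * (h (Suc k) x * h (Suc k) y) * h k y = h (Suc k) y * (h k x * h k y) * h (Suc k) x"
begin

text \<open>With \<open>x = e\<close>, these are the ascending and descending halves of \<open>B(e)\<close>, the product \<open>T(e)\<close> (at \<open>k = 1\<close>), and
  \<open>C(e)\<close> without its factor \<open>z(e)\<close> (at \<open>k = 1\<close>, \<open>y = e - 1\<close>).\<close>

definition ups :: "nat \<Rightarrow> int \<Rightarrow> 'r" where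
  "ups k x = prod_list (map (\<lambda>j. h j x) [k..<n])"

definition downs :: "nat \<Rightarrow> int \<Rightarrow> 'r" where
  "downs k x = prod_list (map (\<lambda>j. h j x) (rev [k..<n]))"

definition stairs :: "nat \<Rightarrow> int \<Rightarrow> 'r" where
  "stairs k x = prod_list (map (\<lambda>i. downs i (x - (int i - int k))) [k..<n])"

definition pairs :: "nat \<Rightarrow> int \<Rightarrow> int \<Rightarrow> 'r" where
  "pairs k x y = prod_list (map (\<lambda>j. h j x * h j (y - (int j - int k))) [k..<n])"

lemma trivial_prods:
  assumes "n \<le> k"
  shows "ups k x = 1" "downs k x = 1" "stairs k x = 1" "pairs k x y = 1"
  using assms by (simp_all add: ups_def downs_def stairs_def pairs_def)

lemma prods_rec:
  assumes "k < n"
  shows "ups k x = h k x * ups (Suc k) x"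
    and "downs k x = downs (Suc k) x * h k x"
    and "stairs k x = downs k x * stairs (Suc k) (x - 1)"
    and "pairs k x y = h k x * h k y * pairs (Suc k) x (y - 1)"
  using assms by (simp_all add: ups_def downs_def stairs_def pairs_def upt_conv_Cons algebra_simps)

lemma commute_prods:
  assumes "\<And>j y. k \<le> j \<Longrightarrow> u * h j y = h j y * u"
  shows "u * ups k x = ups k x * u" "u * downs k x = downs k x * u"
    and "u * stairs k x = stairs k x * u"
proof -
  show "u * ups k x = ups k x * u"
    unfolding ups_def by (rule prod_list_commute) (use assms in auto)
  have d: "u * downs i y = downs i y * u" if "k \<le> i" for i y
    unfolding downs_def by (rule prod_list_commute) (use assms that in auto)
  then show "u * downs k x = downs k x * u"
    by simp
  show "u * stairs k x = stairs k x * u"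
    unfolding stairs_def by (rule prod_list_commute) (use d in auto)
qed

lemma commute_far:
  "h k x * ups (Suc (Suc k)) y = ups (Suc (Suc k)) y * h k x"
  "h k x * downs (Suc (Suc k)) y = downs (Suc (Suc k)) y * h k x"
  by (rule commute_prods, rule h_far, simp)+

text \<open>Downward induction on \<open>k\<close>: peel \<open>h k\<close> off both ends, cross the
  inner runs by induction, commute \<open>h k x\<close> and \<open>h k y\<close> past the runs that
  start at \<open>k + 2\<close>, and apply \<open>h_braid\<close> to what meets in the
  middle.\<close>

lemma ups_downs:
  assumes "1 \<le> k" "k < n"
  shows "ups k x * downs k y = downs (Suc k) y * (h k x * h k y) * ups (Suc k) x"
proof -
  have "k \<le> n - 1" using assms by simp
  then show ?thesis
    using \<open>1 \<le> k\<close>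
  proof (induction k rule: inc_induct)
    case base
    then show ?case using assms by (simp add: prods_rec trivial_prods)
  next
    case (step k)
    then have k: "k < n" "Suc k < n" by auto
    let ?d = "downs (Suc (Suc k)) y" and ?u = "ups (Suc (Suc k)) x"
    have "ups k x * downs k y = h k x * (ups (Suc k) x * downs (Suc k) y) * h k y"
      using k by (simp add: prods_rec mult.assoc)
    also have "\<dots> = (h k x * ?d) * (h (Suc k) x * h (Suc k) y) * (?u * h k y)"
      using step by (simp add: mult.assoc)
    also have "\<dots> = (?d * h k x) * (h (Suc k) x * h (Suc k) y) * (h k y * ?u)"
      by (simp add: commute_far)
    also have "\<dots> = ?d * (h k x * (h (Suc k) x * h (Suc k) y) * h k y) * ?u"
      by (simp add: mult.assoc)
    also have "\<dots> = ?d * (h (Suc k) y * (h k x * h k y) * h (Suc k) x) * ?u"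
      using h_braid step by simp
    also have "\<dots> = downs (Suc k) y * (h k x * h k y) * ups (Suc k) x"
      using k by (simp add: prods_rec mult.assoc)
    finally show ?case .
  qed
qed

text \<open>The ascending run crosses the descending runs one by one. By \<open>ups_downs\<close>
  each crossing strips the lowest factor from both runs and leaves a pair
  \<open>h k x * h k y\<close>, which commutes with all later stripped runs since they start at
  \<open>k + 2\<close>. The stripped runs form the staircase from \<open>Suc k\<close>.\<close>

lemma ups_stairs:
  assumes "1 \<le> k" "k \<le> n"
  shows "ups k x * stairs k y = stairs (Suc k) y * pairs k x y"
  using assms(2,1)
proof (induction k arbitrary: y rule: inc_induct)
  case base
  then show ?case by (simp add: trivial_prods)
next
  case (step k)
  have stairs_Suc: "stairs (Suc k) y = downs (Suc k) y * stairs (Suc (Suc k)) (y - 1)"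
    using step by (cases "Suc k < n") (simp_all add: prods_rec trivial_prods)
  let ?s = "stairs (Suc (Suc k)) (y - 1)" and ?p = "pairs (Suc k) x (y - 1)"
  have comm: "(h k x * h k y) * ?s = ?s * (h k x * h k y)"
    by (rule commute_prods(3)) (metis (no_types) Suc_eq_plus1 add_2_eq_Suc' h_far mult.assoc)
  have "ups k x * stairs k y = (ups k x * downs k y) * stairs (Suc k) (y - 1)"
    using step by (simp add: prods_rec mult.assoc)
  also have "\<dots> = downs (Suc k) y * (h k x * h k y) * (ups (Suc k) x * stairs (Suc k) (y - 1))"
    using step by (simp add: ups_downs mult.assoc)
  also have "\<dots> = downs (Suc k) y * ((h k x * h k y) * ?s) * ?p"
    using step by (simp add: mult.assoc)
  also have "\<dots> = (downs (Suc k) y * ?s) * ((h k x * h k y) * ?p)"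
    unfolding comm by (simp add: mult.assoc)
  also have "\<dots> = stairs (Suc k) y * pairs k x y"
    using step stairs_Suc by (simp add: prods_rec)
  finally show ?case .
qed

text \<open>The identity \<open>B(e) T(e - 1) = T(e) C(e)\<close>. After \<open>ups_stairs\<close>
  the remaining staircase starts at index 2, so \<open>z\<close> passes it, and
  \<open>downs 1 x\<close> becomes its missing first run.\<close>

lemma absorb_stairs:
  assumes "1 \<le> n" and "\<And>j y. 2 \<le> j \<Longrightarrow> z * h j y = h j y * z"
  shows "(downs 1 x * z * ups 1 x) * stairs 1 (x - 1) = stairs 1 x * (z * pairs 1 x (x - 1))"
proof (cases "n = 1")
  case True
  then have "n \<le> 1" by simp
  then show ?thesis by (simp only: trivial_prods mult_1 mult_1_right)
next
  case False
  have "(downs 1 x * z * ups 1 x) * stairs 1 (x - 1)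
      = downs 1 x * (z * stairs 2 (x - 1)) * pairs 1 x (x - 1)"
    using ups_stairs[of 1 x "x - 1"] assms(1) by (simp add: mult.assoc numeral_2_eq_2)
  also have "z * stairs 2 (x - 1) = stairs 2 (x - 1) * z"
    by (rule commute_prods(3)) (use assms in auto)
  finally show ?thesis
    using assms(1) False prods_rec(3)[of 1 x] by (simp add: mult.assoc numeral_2_eq_2)
qed

lemma telescope_stairs:
  assumes "1 \<le> n" and "\<And>x j y. 2 \<le> j \<Longrightarrow> z x * h j y = h j y * z x"
  shows "prod_list (map (\<lambda>i. downs 1 (int i) * z i * ups 1 (int i)) (rev [1..<Suc m])) * stairs 1 0
       = stairs 1 (int m) * prod_list (map (\<lambda>i. z i * pairs 1 (int i) (int i - 1)) (rev [1..<Suc m]))"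
proof (induction m)
  case (Suc m)
  have "(downs 1 (int (Suc m)) * z (Suc m) * ups 1 (int (Suc m))) * stairs 1 (int m)
      = stairs 1 (int (Suc m)) * (z (Suc m) * pairs 1 (int (Suc m)) (int m))"
    using absorb_stairs[OF assms(1), of "z (Suc m)" "int (Suc m)"] assms(2) by simp
  then show ?case
    using Suc by (simp add: mult.assoc) (simp add: mult.assoc[symmetric])
qed simp

end

text \<open>By the quadratic relation \<open>(1 + x * t) * (1 + y * t) = 1 + z * t\<close> for both
  generators, with \<open>z = x + y + \<beta>' * x * y\<close> symmetric in \<open>x\<close> and
  \<open>y\<close>. Both sides then expand to the same six terms, the cubic ones agreeing by the
  braid relation.\<close>

lemma ring_yang_baxter:
  fixes a b x y \<beta>' :: "'r::ring_1"
  assumes c: "\<And>u. x * u = u * x" "\<And>u. y * u = u * y" "\<And>u. \<beta>' * u = u * \<beta>'"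
    and sq: "a * a = \<beta>' * a" "b * b = \<beta>' * b" and br: "a * (b * a) = b * (a * b)"
  shows "(1 + x * a) * ((1 + x * b) * (1 + y * b)) * (1 + y * a)
       = (1 + y * b) * ((1 + x * a) * (1 + y * a)) * (1 + x * b)"
proof -
  define z where "z = x + y + \<beta>' * x * y"
  have cz: "z * u = u * z" for u
  proof -
    have "x * y * u = u * (x * y)" for u by (metis c(1,2) mult.assoc)
    then have "\<beta>' * (x * y) * u = u * (\<beta>' * (x * y))" by (metis c(3) mult.assoc)
    then show ?thesis
      unfolding z_def using c(1)[of u] c(2)[of u] by (simp add: distrib_left distrib_right mult.assoc)
  qed
  have two: "(1 + x * t) * (1 + y * t) = 1 + z * t" if "t * t = \<beta>' * t" for t
  proof -
    have "(x * t) * (y * t) = x * y * (t * t)" by (metis c(2) mult.assoc)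
    also have "\<dots> = \<beta>' * x * y * t" using that by (metis c mult.assoc)
    finally show ?thesis by (simp add: z_def algebra_simps)
  qed
  have three: "(1 + u * s) * (1 + z * t) * (1 + v * s)
      = 1 + z * s + z * t + (u * z) * (s * t) + (z * v) * (t * s) + (u * z * v) * (s * (t * s))"
    if s: "s * s = \<beta>' * s" and uv: "\<And>r. u * r = r * u" "\<And>r. v * r = r * v" and z: "u + v + \<beta>' * u * v = z"
    for s t u v
  proof -
    have 1: "(u * s) * (v * s) = \<beta>' * u * v * s"
      by (metis c(3) mult.assoc s uv(2))
    have 2: "(u * s) * (z * t) = (u * z) * (s * t)" "(z * t) * (v * s) = (z * v) * (t * s)"
      by (metis cz mult.assoc) (metis uv(2) mult.assoc)
    have 3: "(u * z) * (s * t) * (v * s) = (u * z * v) * (s * (t * s))"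
      by (metis uv(2) mult.assoc)
    have "(1 + u * s) * (1 + z * t) * (1 + v * s)
      = 1 + (u * s + v * s + (u * s) * (v * s)) + z * t + (u * s) * (z * t) + (z * t) * (v * s)
        + (u * s) * (z * t) * (v * s)"
      by (simp add: algebra_simps)
    also have "u * s + v * s + (u * s) * (v * s) = z * s"
      unfolding 1 z[symmetric] by (simp add: algebra_simps)
    finally show ?thesis unfolding 2 3 .
  qed
  have "y + x + \<beta>' * y * x = z"
    unfolding z_def by (metis add.commute c(1) mult.assoc)
  note R = three[OF sq(2) c(2) c(1) this, of a]
  have "z * x = x * z" "y * z = z * y" "y * z * x = x * z * y"
    by (metis c cz mult.assoc)+
  then show ?thesis
    unfolding two[OF sq(1)] two[OF sq(2)] R three[OF sq(1) c(1) c(2) z_def[symmetric], of b]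
    by (simp add: br add_ac)
qed

section \<open>Expansion of products of Laurent series\<close>

text \<open>Choosing a summand from every factor selects a subsequence of \<open>ps\<close>;
  distinctness makes different choices give different lists, so the sum may run over a set.\<close>

lemma prod_list_one_plus:
  fixes f :: "'p \<Rightarrow> 'r::semiring_1"
  assumes "distinct ps"
  shows "prod_list (map (\<lambda>p. 1 + f p) ps) = (\<Sum>z\<in>set (subseqs ps). prod_list (map f z))"
  using assms
proof (induction ps)
  case (Cons p ps)
  have disj: "(#) p ` set (subseqs ps) \<inter> set (subseqs ps) = {}"
  proof (rule ccontr)
    assume "(#) p ` set (subseqs ps) \<inter> set (subseqs ps) \<noteq> {}"
    then obtain z where "p # z \<in> set (subseqs ps)" by auto
    then have "p \<in> set ps"
      using subseqs_powset[of ps] by (metis Pow_iff image_eqI list.set_intros(1) subsetD)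
    then show False using Cons.prems by simp
  qed
  have "(\<Sum>z\<in>set (subseqs (p # ps)). prod_list (map f z))
      = (\<Sum>z\<in>(#) p ` set (subseqs ps). prod_list (map f z)) + (\<Sum>z\<in>set (subseqs ps). prod_list (map f z))"
    using sum.union_disjoint[OF _ _ disj, of "\<lambda>z. prod_list (map f z)"] by (simp add: Let_def)
  also have "(\<Sum>z\<in>(#) p ` set (subseqs ps). prod_list (map f z)) = f p * (\<Sum>z\<in>set (subseqs ps). prod_list (map f z))"
    by (subst sum.reindex) (simp_all add: sum_distrib_left)
  finally show ?case
    using Cons by (simp add: distrib_right add.commute)
qed simp

text \<open>Asymmetry leaves only one order in which chosen entries of \<open>ps\<close> can be
  sorted. Thus the subsequences in the expansion of a product over sorted positions become
  biwords.\<close>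

lemma set_subseqs_sorted_wrt:
  assumes "asymp lt" "sorted_wrt lt ps"
  shows "set (subseqs ps) = {z. sorted_wrt lt z \<and> set z \<subseteq> set ps}"
  using assms(2)
proof (induction ps)
  case (Cons p ps)
  have "z \<in> (#) p ` set (subseqs ps) \<union> set (subseqs ps)"
    if "sorted_wrt lt z" "set z \<subseteq> set (p # ps)" for z
  proof (cases z)
    case Nil
    then show ?thesis using Cons by simp
  next
    case (Cons y z')
    have asym: "lt a b \<Longrightarrow> \<not> lt b a" for a b using assms(1) by (rule asympD)
    have pz: "p \<notin> set z'"
      using that Cons Cons.prems asym by (metis insertE list.set(2) list.set_intros(1) sorted_wrt.simps(2) subsetD)
    show ?thesis
    proof (cases "y = p")
      case True
      have "set z' \<subseteq> set ps" using that(2) pz Cons by auto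
      then show ?thesis using Cons.IH Cons.prems True Cons that(1) by auto
    next
      case False
      have "set z \<subseteq> set ps" using that(2) pz Cons False by auto
      then show ?thesis using Cons.IH Cons.prems that(1) by auto
    qed
  qed
  moreover have "sorted_wrt lt z \<and> set z \<subseteq> set (p # ps)"
    if "z \<in> (#) p ` set (subseqs ps) \<union> set (subseqs ps)" for z
    using that Cons.IH Cons.prems by (auto simp: subset_iff)
  ultimately show ?case
    by (auto simp: Let_def simp del: sorted_wrt.simps)
qed auto

section \<open>Monomials and order estimates over a possibly noncommutative coefficient ring\<close>

definition fls_monom :: "int \<Rightarrow> 'a::zero \<Rightarrow> 'a fls" where
  "fls_monom e a = fls_shift (- e) (fls_const a)"

lemma fls_monom_nth [simp]: "fls_nth (fls_monom e a) k = (if k = e then a else 0)"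
  by (auto simp: fls_monom_def)

lemma fls_monom_mult: "fls_monom e a * fls_monom f b = fls_monom (e + f) (a * b :: 'a::semiring_0)"
  by (simp add: fls_monom_def fls_shifted_times_simps fls_const_mult_const algebra_simps)

lemma fls_monom_0_1 [simp]: "fls_monom 0 1 = 1"
  by (simp add: fls_monom_def)

lemma fls_monom_central: "(\<And>u. a * u = u * a) \<Longrightarrow> fls_monom e a * F = F * fls_monom e (a :: 'a::semiring_1)"
  by (rule fls_eqI) (simp add: fls_monom_def fls_shifted_times_simps fls_mult_const_nth)

lemma prod_list_fls_monom:
  "prod_list (map (\<lambda>p. fls_monom (e p) (f p)) z)
   = fls_monom (sum_list (map e z)) (prod_list (map f z) :: 'a::semiring_1)"
  by (induction z) (simp_all add: fls_monom_mult)

lemma nth_prod_list_one_plus_monom: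
  fixes f :: "'p \<Rightarrow> 'r::ring_1"
  assumes "distinct ps"
  shows "fls_nth (prod_list (map (\<lambda>p. 1 + fls_monom (e p) (f p)) ps)) k
       = (\<Sum>z | z \<in> set (subseqs ps) \<and> sum_list (map e z) = k. prod_list (map f z))"
proof -
  have "fls_nth (\<Sum>z\<in>A. g z) k = (\<Sum>z\<in>A. fls_nth (g z) k)" for A and g :: "'p list \<Rightarrow> 'r fls"
    by (induction A rule: infinite_finite_induct) auto
  moreover have "(\<Sum>z\<in>set (subseqs ps). if k = sum_list (map e z) then prod_list (map f z) else 0)
    = (\<Sum>z | z \<in> set (subseqs ps) \<and> sum_list (map e z) = k. prod_list (map f z))"
    by (rule sum.mono_neutral_cong_right) auto
  ultimately show ?thesis
    unfolding prod_list_one_plus[OF assms] prod_list_fls_monom by simp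
qed

text \<open>The product \<open>u * g\<close> has order at least \<open>a + b\<close>. This is how a
  factor close to 1 is discarded when a fixed coefficient is computed.\<close>

lemma fls_nth_mult_one_plus:
  fixes u g :: "'r::ring_1 fls"
  assumes "\<And>j. j < a \<Longrightarrow> fls_nth u j = 0" "\<And>j. j < b \<Longrightarrow> fls_nth g j = 0" "k < a + b"
  shows "fls_nth ((1 + u) * g) k = fls_nth g k"
proof -
  have "fls_nth (u * g) k = 0"
  proof (cases "u = 0 \<or> g = 0")
    case False
    have "a \<le> fls_subdegree u" "b \<le> fls_subdegree g"
      using assms(1,2) False by (metis nth_fls_subdegree_nonzero not_le)+
    then show ?thesis using assms(3) by (intro fls_times_nth_eq0) simp
  qed auto
  then show ?thesis by (simp add: distrib_right)
qed

text \<open>Weights may be negative, but only finitely many elements have weight at most 0 and a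
  distinct list uses each at most once. So \<open>c\<close>, the sum of their absolute values,
  bounds the loss; applying the bound to the list without \<open>p\<close> controls
  \<open>e p\<close>.\<close>

lemma distinct_lists_bounded_weight:
  fixes e :: "'p \<Rightarrow> int"
  assumes fin: "\<And>K. finite {p \<in> Q. e p \<le> K}"
  shows "\<exists>c. \<forall>z. distinct z \<and> set z \<subseteq> Q \<longrightarrow>
    - c \<le> sum_list (map e z) \<and> (\<forall>p\<in>set z. e p \<le> sum_list (map e z) + c)"
proof -
  define c where "c = (\<Sum>p | p \<in> Q \<and> e p \<le> 0. - e p)"
  have low: "- c \<le> (\<Sum>p\<in>A. e p)" if "A \<subseteq> Q" "finite A" for A
  proof -
    have "(\<Sum>p\<in>A. - e p) \<le> (\<Sum>p | p \<in> A \<and> e p \<le> 0. - e p)"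
      by (subst sum.inter_filter[OF that(2)]) (auto intro: sum_mono)
    also have "\<dots> \<le> c"
      unfolding c_def by (rule sum_mono2) (use that fin[of 0] in auto)
    finally show ?thesis by (simp add: sum_negf)
  qed
  show ?thesis
  proof (intro exI[of _ c] allI impI conjI ballI; elim conjE)
    fix z :: "'p list" assume z: "distinct z" "set z \<subseteq> Q"
    then have s: "sum_list (map e z) = (\<Sum>p\<in>set z. e p)"
      by (simp add: sum_list_distinct_conv_sum_set)
    show "- c \<le> sum_list (map e z)"
      unfolding s using z by (intro low) auto
    fix p assume "p \<in> set z"
    then have "(\<Sum>p\<in>set z. e p) = e p + (\<Sum>p\<in>set z - {p}. e p)"
      by (simp add: sum.remove)
    moreover have "- c \<le> (\<Sum>p\<in>set z - {p}. e p)"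
      using z by (intro low) auto
    ultimately show "e p \<le> sum_list (map e z) + c"
      unfolding s by simp
  qed
qed

section \<open>Biwords\<close>

type_synonym position = "int \<times> letter"

text \<open>A biword is a list of positions \<open>(i, c)\<close>: the letters \<open>c\<close> form the word and the indices \<open>i\<close> a sequence. Those of
  kind L encode the compatible sequences of the left-hand side, those of kind R the sequences that
  expand \<open>1 / ((q - 1) \<dots> (q\<^sup>N - 1))\<close>; the weights are exponents of \<open>X = 1 / q\<close>.\<close>

definition lt_L :: "position \<Rightarrow> position \<Rightarrow> bool" where
  "lt_L p q \<longleftrightarrow> fst p < fst q \<or> fst p = fst q \<and> rank_std (snd q) < rank_std (snd p)"

definition lt_R :: "position \<Rightarrow> position \<Rightarrow> bool" where
  "lt_R p q \<longleftrightarrow> fst p < fst q \<or> fst p = fst q \<and> rank_prec (snd p) < rank_prec (snd q)"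

text \<open>The exponent of \<open>X\<close> in the value of \<open>x i\<close> at \<open>q\<close>
  to the power \<open>i - 1\<close>.\<close>

definition wt_L :: "position \<Rightarrow> int" where
  "wt_L p = 1 - fst p"

text \<open>The second summand accounts for the factor \<open>q\<close> to the power
  \<open>Sigma_BC\<close>.\<close>

definition wt_R :: "position \<Rightarrow> int" where
  "wt_R p = - fst p - max 0 (val (snd p))"

definition dom_L :: "letter set \<Rightarrow> position set" where
  "dom_L A = {p. snd p \<in> A \<and> (0 < fst p \<longrightarrow> fst p \<le> val (snd p))}"

definition dom_R :: "letter set \<Rightarrow> position set" where
  "dom_R A = {p. snd p \<in> A \<and> fst p \<le> - 1}"

definition biwords_L :: "letter set \<Rightarrow> position list set" where
  "biwords_L A = {z. sorted_wrt lt_L z \<and> set z \<subseteq> dom_L A}"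

definition biwords_R :: "letter set \<Rightarrow> position list set" where
  "biwords_R A = {z. sorted_wrt lt_R z \<and> set z \<subseteq> dom_R A}"

lemma asymp_lt: "asymp lt_L" "asymp lt_R"
  by (auto intro!: asympI simp: lt_L_def lt_R_def)

lemma transp_lt: "transp lt_L" "transp lt_R"
  by (auto intro!: transpI simp: lt_L_def lt_R_def)

lemma sorted_wrt_asymp_distinct: "asymp lt \<Longrightarrow> sorted_wrt lt z \<Longrightarrow> distinct z"
  by (induction z) (auto dest: asympD)

lemma val_less: "a \<in> alphabet_C n \<Longrightarrow> val a < int n"
  by (cases a) (auto simp: alphabet_C_def)

lemma finite_dom_L:
  assumes "A \<subseteq> alphabet_C n"
  shows "finite {p \<in> dom_L A. wt_L p \<le> K}"
proof (rule finite_subset)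
  show "{p \<in> dom_L A. wt_L p \<le> K} \<subseteq> {min 0 (1 - K)..int n} \<times> alphabet_C n"
  proof
    fix p assume p: "p \<in> {p \<in> dom_L A. wt_L p \<le> K}"
    then have "val (snd p) < int n"
      using assms val_less by (auto simp: dom_L_def)
    then show "p \<in> {min 0 (1 - K)..int n} \<times> alphabet_C n"
      using p assms by (cases p) (auto simp: dom_L_def wt_L_def)
  qed
qed (simp add: finite_alphabet_C)

lemma finite_dom_R:
  assumes "A \<subseteq> alphabet_C n"
  shows "finite {p \<in> dom_R A. wt_R p \<le> K}"
proof (rule finite_subset)
  show "{p \<in> dom_R A. wt_R p \<le> K} \<subseteq> {- K - int n..0} \<times> alphabet_C n"
  proof
    fix p assume p: "p \<in> {p \<in> dom_R A. wt_R p \<le> K}"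
    then have "val (snd p) < int n"
      using assms val_less by (auto simp: dom_R_def)
    then show "p \<in> {- K - int n..0} \<times> alphabet_C n"
      using p assms by (cases p) (auto simp: dom_R_def wt_R_def)
  qed
qed (simp add: finite_alphabet_C)

section \<open>Sorted lists of all positions in a finite range of indices\<close>

definition letters_L :: "nat \<Rightarrow> letter list" where
  "letters_L n = map Pos (rev [0..<n]) @ map Neg [0..<n]"

definition letters_R :: "nat \<Rightarrow> letter list" where
  "letters_R n = concat (map (\<lambda>k. [Neg k, Pos k]) [0..<n])"

lemma set_letters: "set (letters_L n) = alphabet_C n" "set (letters_R n) = alphabet_C n"
proof -
  have "c \<in> alphabet_C n \<longleftrightarrow> c \<in> Pos ` {..<n} \<union> Neg ` {..<n}" for c
    by (cases c) (auto simp: alphabet_C_def)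
  then show "set (letters_L n) = alphabet_C n" "set (letters_R n) = alphabet_C n"
    by (auto simp: letters_L_def letters_R_def)
qed

lemma sorted_letters:
  "sorted_wrt (\<lambda>c d. rank_std d < rank_std c) (letters_L n)"
  "sorted_wrt (\<lambda>c d. rank_prec c < rank_prec d) (letters_R n)"
  by (induction n) (auto simp: letters_L_def letters_R_def sorted_wrt_append)

text \<open>Blocks gather the positions of one index, so that their products are the factors
  \<open>B(e)\<close> (index \<open>1 - e\<close>), the runs of \<open>T(0)\<close> (positive index)
  and, for \<open>block_R\<close>, \<open>C(e)\<close> (index \<open>- e\<close>).\<close>

definition block_L :: "letter set \<Rightarrow> nat \<Rightarrow> int \<Rightarrow> position list" where
  "block_L A n i = map (Pair i) (filter (\<lambda>c. c \<in> A \<and> (0 < i \<longrightarrow> i \<le> val c)) (letters_L n))"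

definition block_R :: "letter set \<Rightarrow> nat \<Rightarrow> int \<Rightarrow> position list" where
  "block_R A n i = map (Pair i) (filter (\<lambda>c. c \<in> A) (letters_R n))"

definition list_L :: "letter set \<Rightarrow> nat \<Rightarrow> nat \<Rightarrow> position list" where
  "list_L A n m = concat (map (block_L A n) [1 - int m..int n - 1])"

definition list_R :: "letter set \<Rightarrow> nat \<Rightarrow> nat \<Rightarrow> position list" where
  "list_R A n m = concat (map (block_R A n) [- int m..- 1])"

lemma sorted_wrt_concat_map:
  assumes "sorted_wrt R xs" "\<And>x. sorted_wrt S (f x)"
    and "\<And>x y p q. R x y \<Longrightarrow> p \<in> set (f x) \<Longrightarrow> q \<in> set (f y) \<Longrightarrow> S p q"
  shows "sorted_wrt S (concat (map f xs))"
  using assms(1) by (induction xs) (use assms(2,3) in \<open>auto simp: sorted_wrt_append\<close>)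

lemma sorted_list_L: "sorted_wrt lt_L (list_L A n m)"
  unfolding list_L_def
proof (rule sorted_wrt_concat_map[OF sorted_wrt_upto])
  show "sorted_wrt lt_L (block_L A n i)" for i
    unfolding block_L_def sorted_wrt_map
    by (rule sorted_wrt_filter) (use sorted_letters(1) in \<open>simp add: lt_L_def\<close>)
qed (auto simp: block_L_def lt_L_def)

lemma sorted_list_R: "sorted_wrt lt_R (list_R A n m)"
  unfolding list_R_def
proof (rule sorted_wrt_concat_map[OF sorted_wrt_upto])
  show "sorted_wrt lt_R (block_R A n i)" for i
    unfolding block_R_def sorted_wrt_map
    by (rule sorted_wrt_filter) (use sorted_letters(2) in \<open>simp add: lt_R_def\<close>)
qed (auto simp: block_R_def lt_R_def)

lemma set_block:
  assumes "A \<subseteq> alphabet_C n"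
  shows "set (block_L A n i) = {p \<in> dom_L A. fst p = i}"
    and "i \<le> - 1 \<Longrightarrow> set (block_R A n i) = {p \<in> dom_R A. fst p = i}"
  using assms by (auto simp: block_L_def block_R_def set_letters dom_L_def dom_R_def)

lemma set_list_L:
  assumes "A \<subseteq> alphabet_C n" "n \<ge> 1"
  shows "set (list_L A n m) = {p \<in> dom_L A. 1 - int m \<le> fst p}"
proof -
  have "i \<le> int n - 1" if "(i, c) \<in> dom_L A" for i c
    using that assms val_less[of c n] by (auto simp: dom_L_def)
  then show ?thesis
    using assms by (auto simp: list_L_def set_block)
qed

lemma set_list_R:
  assumes "A \<subseteq> alphabet_C n"
  shows "set (list_R A n m) = {p \<in> dom_R A. - int m \<le> fst p}"
proof -
  have "i \<le> - 1" if "(i, c) \<in> dom_R A" for i c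
    using that by (auto simp: dom_R_def)
  then show ?thesis
    using assms by (auto simp: list_R_def set_block)
qed

lemma upto_conv_rev_upt:
  "[1 - int m..0] = map (\<lambda>e. 1 - int e) (rev [1..<Suc m])"
  "[- int m..- 1] = map (\<lambda>e. - int e) (rev [1..<Suc m])"
  by (induction m) (simp_all add: upto_rec1)

lemma upto_conv_upt: "[1..int n - 1] = map int [1..<n]"
  by (rule nth_equalityI) auto

lemma list_L_conv:
  assumes "n \<ge> 1"
  shows "list_L A n m = concat (map (\<lambda>e. block_L A n (1 - int e)) (rev [1..<Suc m]))
    @ concat (map (\<lambda>i. block_L A n (int i)) [1..<n])"
proof -
  have "[1 - int m..int n - 1] = [1 - int m..0] @ [1..int n - 1]"
    using upto_split2[of "1 - int m" 0 "int n - 1"] assms by (cases m) auto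
  then show ?thesis
    unfolding list_L_def upto_conv_rev_upt upto_conv_upt by (simp add: comp_def)
qed

lemma list_R_conv:
  "list_R A n m = concat (map (\<lambda>e. block_R A n (- int e)) (rev [1..<Suc m]))"
  unfolding list_R_def upto_conv_rev_upt by (simp add: comp_def)

lemma prod_list_concat_map:
  "prod_list (map g (concat (map f xs))) = prod_list (map (\<lambda>x. prod_list (map g (f x))) xs :: 'r::monoid_mult list)"
  by (induction xs) auto

lemma filter_Pos_upt:
  assumes "alphabet_B n \<subseteq> A" "k \<le> n"
  shows "filter (\<lambda>c. c \<in> A \<and> int k \<le> val c) (map Pos (rev [0..<n])) = map Pos (rev [k..<n])"
proof -
  have "[0..<n] = [0..<k] @ [k..<n]"
    using upt_add_eq_append[of 0 k "n - k"] assms(2) by simp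
  moreover have "Pos j \<in> A" if "j < n" for j
    using assms that by (auto simp: alphabet_B_def alphabet_C_def)
  ultimately show ?thesis
    by (auto simp: rev_filter[symmetric] filter_map comp_def intro!: filter_True filter_False)
qed

section \<open>Products over blocks as Yang--Baxter products\<close>

context yang_baxter
begin

text \<open>The factor \<open>z(e)\<close>: \<open>Neg 0\<close> and \<open>Pos 0\<close> act
  through the same generator with the same weight, whence the square in type C.\<close>

definition h_zero :: "letter set \<Rightarrow> int \<Rightarrow> 'r" where
  "h_zero A x = h 0 x * (if Neg 0 \<in> A then h 0 x else 1)"

abbreviation prod_positions :: "(position \<Rightarrow> int) \<Rightarrow> position list \<Rightarrow> 'r" where
  "prod_positions wt ps \<equiv> prod_list (map (\<lambda>p. h (absv (snd p)) (wt p)) ps)"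

text \<open>The alphabets of types B and C differ only in \<open>Neg 0\<close>, so an
  \<open>A\<close> between them covers both at once.\<close>

lemma filter_mem_alphabet:
  assumes "alphabet_B n \<subseteq> A" "A \<subseteq> alphabet_C n" "n \<ge> 1"
  shows "filter (\<lambda>c. c \<in> A) (letters_L n)
      = map Pos (rev [1..<n]) @ Pos 0 # (if Neg 0 \<in> A then [Neg 0] else []) @ map Neg [1..<n]"
    and "filter (\<lambda>c. c \<in> A) (letters_R n)
      = (if Neg 0 \<in> A then [Neg 0] else []) @ Pos 0 # concat (map (\<lambda>k. [Neg k, Pos k]) [1..<n])"
proof -
  have n0: "[0..<n] = 0 # [1..<n]"
    using assms(3) by (simp add: upt_conv_Cons)
  have mem: "Pos j \<in> A" "j \<noteq> 0 \<Longrightarrow> Neg j \<in> A" if "j < n" for j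
    using assms that by (auto simp: alphabet_B_def alphabet_C_def)
  have f: "filter (\<lambda>c. c \<in> A) xs = xs" if "set xs \<subseteq> alphabet_B n" for xs
    using that assms(1) by (auto intro: filter_True)
  show "filter (\<lambda>c. c \<in> A) (letters_L n)
      = map Pos (rev [1..<n]) @ Pos 0 # (if Neg 0 \<in> A then [Neg 0] else []) @ map Neg [1..<n]"
    unfolding letters_L_def n0 using mem assms(3)
    by (auto simp: alphabet_B_def alphabet_C_def intro!: f)
  show "filter (\<lambda>c. c \<in> A) (letters_R n)
      = (if Neg 0 \<in> A then [Neg 0] else []) @ Pos 0 # concat (map (\<lambda>k. [Neg k, Pos k]) [1..<n])"
    unfolding letters_R_def n0 using mem assms(3)
    by (auto simp: alphabet_B_def alphabet_C_def intro!: f)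
qed

text \<open>At the index \<open>1 - e \<le> 0\<close> compatibility imposes no bound and all letters
  of \<open>A\<close> occur. At a positive index \<open>k\<close> only the letters
  \<open>Pos j\<close> with \<open>j \<ge> k\<close> survive.\<close>

lemma prod_block_L:
  assumes "alphabet_B n \<subseteq> A" "A \<subseteq> alphabet_C n" "n \<ge> 1"
  shows "1 \<le> e \<Longrightarrow> prod_positions wt_L (block_L A n (1 - int e)) = downs 1 (int e) * h_zero A (int e) * ups 1 (int e)"
    and "1 \<le> k \<Longrightarrow> k < n \<Longrightarrow> prod_positions wt_L (block_L A n (int k)) = downs k (1 - int k)"
proof -
  assume "1 \<le> e"
  then have "block_L A n (1 - int e) = map (Pair (1 - int e)) (filter (\<lambda>c. c \<in> A) (letters_L n))"
    by (auto simp: block_L_def intro: filter_cong)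
  then show "prod_positions wt_L (block_L A n (1 - int e)) = downs 1 (int e) * h_zero A (int e) * ups 1 (int e)"
    unfolding filter_mem_alphabet[OF assms]
    by (simp add: comp_def wt_L_def downs_def ups_def h_zero_def mult.assoc)
next
  assume k: "1 \<le> k" "k < n"
  have "filter (\<lambda>c. c \<in> A \<and> int k \<le> val c) (map Neg [0..<n]) = []"
    using k by (auto intro!: filter_False)
  then have "block_L A n (int k) = map (Pair (int k)) (map Pos (rev [k..<n]))"
    using k filter_Pos_upt[OF assms(1), of k] by (simp add: block_L_def letters_L_def)
  then show "prod_positions wt_L (block_L A n (int k)) = downs k (1 - int k)"
    by (simp add: comp_def wt_L_def downs_def)
qed

text \<open>At index \<open>- e\<close> the letter \<open>Neg k\<close> has weight \<open>e\<close>
  and \<open>Pos k\<close> has weight \<open>e - k\<close>; they are neighbours in the order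
  \<open>\<prec>\<close> and so produce the pairs of \<open>C(e)\<close>.\<close>

lemma prod_block_R:
  assumes "alphabet_B n \<subseteq> A" "A \<subseteq> alphabet_C n" "n \<ge> 1"
  shows "prod_positions wt_R (block_R A n (- int e)) = h_zero A (int e) * pairs 1 (int e) (int e - 1)"
proof -
  have "prod_positions wt_R (map (Pair (- int e)) (concat (map (\<lambda>k. [Neg k, Pos k]) [1..<n])))
      = pairs 1 (int e) (int e - 1)"
  proof -
    have "map (Pair (- int e)) (concat (map (\<lambda>k. [Neg k, Pos k]) [1..<n]))
        = concat (map (\<lambda>k. [(- int e, Neg k), (- int e, Pos k)]) [1..<n])"
      by (simp add: map_concat comp_def)
    then show ?thesis
      unfolding pairs_def by (simp only: prod_list_concat_map) (simp add: wt_R_def)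
  qed
  then show ?thesis
    unfolding block_R_def filter_mem_alphabet[OF assms]
    by (simp add: wt_R_def h_zero_def mult.assoc)
qed

lemma prod_list_L_eq:
  assumes "alphabet_B n \<subseteq> A" "A \<subseteq> alphabet_C n" "n \<ge> 1"
  shows "prod_positions wt_L (list_L A n m) = stairs 1 (int m) * prod_positions wt_R (list_R A n m)"
proof -
  have far: "h_zero A x * h j y = h j y * h_zero A x" if "2 \<le> j" for x j y
    using h_far[of 0 j x y] that by (simp add: h_zero_def) (metis mult.assoc)
  have "prod_positions wt_L (list_L A n m)
      = prod_list (map (\<lambda>e. downs 1 (int e) * h_zero A (int e) * ups 1 (int e)) (rev [1..<Suc m])) * stairs 1 0"
  proof -
    have "map (\<lambda>e. prod_positions wt_L (block_L A n (1 - int e))) (rev [1..<Suc m])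
        = map (\<lambda>e. downs 1 (int e) * h_zero A (int e) * ups 1 (int e)) (rev [1..<Suc m])"
      by (rule map_cong) (use prod_block_L(1)[OF assms] in auto)
    \<comment> \<open>The arguments \<open>1 - i\<close> are those of the runs in
      \<open>stairs 1 0\<close>, so the positive indices contribute \<open>T(0)\<close>.\<close>
    moreover have "map (\<lambda>i. prod_positions wt_L (block_L A n (int i))) [1..<n]
        = map (\<lambda>i. downs i (0 - (int i - int 1))) [1..<n]"
      by (rule map_cong) (use prod_block_L(2)[OF assms] in auto)
    ultimately show ?thesis
      unfolding list_L_conv[OF assms(3)] map_append prod_list.append prod_list_concat_map stairs_def by argo
  qed
  also have "\<dots> = stairs 1 (int m) * prod_list (map (\<lambda>i. h_zero A (int i) * pairs 1 (int i) (int i - 1)) (rev [1..<Suc m]))"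
    using telescope_stairs[OF assms(3), of "\<lambda>i. h_zero A (int i)"] far by simp
  also have "\<dots> = stairs 1 (int m) * prod_positions wt_R (list_R A n m)"
    unfolding list_R_conv prod_list_concat_map prod_block_R[OF assms] ..
  finally show ?thesis .
qed

end

section \<open>Comparison of the two products\<close>

text \<open>A bound on the total weight bounds every single weight, leaving finitely many possible
  entries, hence finitely many distinct lists.\<close>

lemma finite_distinct_lists_weight:
  fixes e :: "'p \<Rightarrow> int"
  assumes fin: "\<And>K. finite {p \<in> Q. e p \<le> K}"
  shows "finite {z. distinct z \<and> set z \<subseteq> Q \<and> sum_list (map e z) \<le> k}"
proof -
  obtain c where c: "\<And>z p. distinct z \<Longrightarrow> set z \<subseteq> Q \<Longrightarrow> p \<in> set z \<Longrightarrow> e p \<le> sum_list (map e z) + c"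
    using distinct_lists_bounded_weight[of Q e, OF fin] by metis
  have "e p \<le> k + c" if "distinct z" "set z \<subseteq> Q" "sum_list (map e z) \<le> k" "p \<in> set z" for z p
    using c[OF that(1,2,4)] that(3) by simp
  then have "{z. distinct z \<and> set z \<subseteq> Q \<and> sum_list (map e z) \<le> k}
      \<subseteq> {z. set z \<subseteq> {p \<in> Q. e p \<le> k + c} \<and> distinct z}"
    by blast
  then show ?thesis
    by (rule finite_subset) (rule finite_subset_distinct[OF fin])
qed

lemma finite_biwords:
  assumes "A \<subseteq> alphabet_C n"
  shows "finite {z \<in> biwords_L A. sum_list (map wt_L z) \<le> k}"
    and "finite {z \<in> biwords_R A. sum_list (map wt_R z) \<le> k}"
proof -
  show "finite {z \<in> biwords_L A. sum_list (map wt_L z) \<le> k}"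
    using finite_distinct_lists_weight[OF finite_dom_L[OF assms], of k]
    by (rule rev_finite_subset) (auto simp: biwords_L_def sorted_wrt_asymp_distinct[OF asymp_lt(1)])
  show "finite {z \<in> biwords_R A. sum_list (map wt_R z) \<le> k}"
    using finite_distinct_lists_weight[OF finite_dom_R[OF assms], of k]
    by (rule rev_finite_subset) (auto simp: biwords_R_def sorted_wrt_asymp_distinct[OF asymp_lt(2)])
qed

text \<open>Congruence to 1 modulo \<open>X\<close> to the power \<open>a\<close> passes to products
  by \<open>f * g - 1 = f * (g - 1) + (f - 1)\<close>; with \<open>a \<ge> 0\<close>, multiplying by
  \<open>f\<close> does not lower the order of \<open>g - 1\<close>.\<close>

lemma fls_nth_prod_list_minus_one:
  fixes fs :: "'r::ring_1 fls list"
  assumes "\<And>f j. f \<in> set fs \<Longrightarrow> j < a \<Longrightarrow> fls_nth (f - 1) j = 0" "0 \<le> a" "j < a"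
  shows "fls_nth (prod_list fs - 1) j = 0"
  using assms(1,3)
proof (induction fs arbitrary: j)
  case (Cons f fs)
  have IH: "fls_nth (prod_list fs - 1) i = 0" if "i < a" for i
    by (rule Cons.IH) (use Cons.prems that in auto)
  have f: "fls_nth (f - 1) i = 0" if "i < a" for i
    by (rule Cons.prems) (use that in auto)
  have "fls_nth ((1 + (f - 1)) * (prod_list fs - 1)) j = fls_nth (prod_list fs - 1) j"
    by (rule fls_nth_mult_one_plus[OF f IH]) (use Cons.prems(2) assms(2) in auto)
  moreover have "prod_list (f # fs) - 1 = (1 + (f - 1)) * (prod_list fs - 1) + (f - 1)"
    by (simp add: algebra_simps)
  ultimately show ?case
    using IH[OF Cons.prems(2)] f[OF Cons.prems(2)] by (simp only: fls_plus_nth add_0_left)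
qed simp

text \<open>The element \<open>b\<close> is the scalar \<open>\<beta>\<close> seen as a central
  element of the coefficient ring.\<close>

locale hecke_relations =
  fixes P :: "nat \<Rightarrow> 'r::ring_1" and b :: 'r
  assumes b_central: "b * u = u * b"
    and P_square: "P j * P j = b * P j"
    and P_far: "j + 2 \<le> k \<Longrightarrow> P j * P k = P k * P j"
    and P_braid: "1 \<le> k \<Longrightarrow> P k * (P (Suc k) * P k) = P (Suc k) * (P k * P (Suc k))"
begin

definition factor :: "nat \<Rightarrow> int \<Rightarrow> 'r fls" where
  "factor j e = 1 + fls_monom e (P j)"

sublocale yang_baxter factor n for n
proof
  \<comment> \<open>Separates the central power of \<open>X\<close> from the constant series
    \<open>P j\<close>, as \<open>ring_yang_baxter\<close> requires.\<close>
  have scal: "fls_monom e (P j) = fls_monom e 1 * fls_monom 0 (P j)" for e j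
    by (simp add: fls_monom_mult)
  have cent: "fls_monom e 1 * u = u * fls_monom e 1" for e and u :: "'r fls"
    by (rule fls_monom_central) simp
  show "factor j x * factor k y = factor k y * factor j x" if "j + 2 \<le> k" for j k x y
    using P_far[OF that] by (simp add: factor_def fls_monom_mult algebra_simps)
  show "factor k x * (factor (Suc k) x * factor (Suc k) y) * factor k y
      = factor (Suc k) y * (factor k x * factor k y) * factor (Suc k) x" if "1 \<le> k" for k x y
    unfolding factor_def scal[of x] scal[of y]
  proof (rule ring_yang_baxter[where \<beta>' = "fls_monom 0 b"])
    show "fls_monom 0 b * u = u * fls_monom 0 b" for u
      by (rule fls_monom_central) (rule b_central)
    show "fls_monom 0 (P k) * (fls_monom 0 (P (Suc k)) * fls_monom 0 (P k))
        = fls_monom 0 (P (Suc k)) * (fls_monom 0 (P k) * fls_monom 0 (P (Suc k)))"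
      using P_braid[OF that] by (simp add: fls_monom_mult)
  qed (rule cent, rule cent, simp_all add: fls_monom_mult P_square)
qed

text \<open>Every exponent in \<open>T(m)\<close> is at least \<open>m - n\<close>; this quantifies
  that \<open>T(m)\<close> tends to 1.\<close>

lemma stairs_minus_one:
  assumes "1 \<le> n" "j < int m - int n" "n \<le> m"
  shows "fls_nth (stairs n 1 (int m) - 1) j = 0"
  unfolding stairs_def
proof (rule fls_nth_prod_list_minus_one[where a = "int m - int n"])
  fix f j assume "f \<in> set (map (\<lambda>i. downs n i (int m - (int i - int 1))) [1..<n])" and j: "j < int m - int n"
  then obtain i where i: "i < n" and f: "f = downs n i (int m - (int i - 1))"
    by auto
  show "fls_nth (f - 1) j = 0"
    unfolding f downs_def
    by (rule fls_nth_prod_list_minus_one[where a = "int m - int n"])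
      (use i j assms in \<open>auto simp: factor_def\<close>)
qed (use assms in auto)

text \<open>Compare the coefficients of degree \<open>k\<close> in \<open>prod_list_L_eq\<close>.
  For large \<open>m\<close> the truncation loses no biword of weight \<open>k\<close> and
  \<open>T(m)\<close> does not affect this degree.\<close>

lemma biword_sums_eq:
  assumes A: "alphabet_B n \<subseteq> A" "A \<subseteq> alphabet_C n" and n: "n \<ge> 1"
  shows "(\<Sum>z | z \<in> biwords_L A \<and> sum_list (map wt_L z) = k. prod_list (map (\<lambda>p. P (absv (snd p))) z))
       = (\<Sum>z | z \<in> biwords_R A \<and> sum_list (map wt_R z) = k. prod_list (map (\<lambda>p. P (absv (snd p))) z))"
proof -
  obtain c where c: "\<And>z p. distinct z \<Longrightarrow> set z \<subseteq> dom_L A \<Longrightarrow> p \<in> set z \<Longrightarrow> wt_L p \<le> sum_list (map wt_L z) + c"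
    using distinct_lists_bounded_weight[of "dom_L A" wt_L, OF finite_dom_L[OF A(2)]] by metis
  obtain d where d: "\<And>z. distinct z \<Longrightarrow> set z \<subseteq> dom_R A \<Longrightarrow> - d \<le> sum_list (map wt_R z)"
      "\<And>z p. distinct z \<Longrightarrow> set z \<subseteq> dom_R A \<Longrightarrow> p \<in> set z \<Longrightarrow> wt_R p \<le> sum_list (map wt_R z) + d"
    using distinct_lists_bounded_weight[of "dom_R A" wt_R, OF finite_dom_R[OF A(2)]] by metis
  \<comment> \<open>The summands with \<open>k\<close>, \<open>c\<close>, \<open>d\<close> and
    \<open>n\<close> keep all entries of biwords of weight \<open>k\<close> inside
    \<open>list_L\<close> and \<open>list_R\<close>, and also give \<open>k < (m - n) - d\<close>,
    where \<open>- d\<close> bounds the order of the right product from below.\<close>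
  define m where "m = nat (\<bar>k\<bar> + \<bar>c\<bar> + \<bar>d\<bar> + int n + 1)"
  let ?g = "\<lambda>p. P (absv (snd p))"
  have dist: "distinct (list_L A n m)" "distinct (list_R A n m)"
    using sorted_list_L sorted_list_R asymp_lt sorted_wrt_asymp_distinct by blast+
  have subs_L: "set (subseqs (list_L A n m)) = {z \<in> biwords_L A. \<forall>p\<in>set z. 1 - int m \<le> fst p}"
    unfolding set_subseqs_sorted_wrt[OF asymp_lt(1) sorted_list_L] set_list_L[OF A(2) n] biwords_L_def by auto
  have subs_R: "set (subseqs (list_R A n m)) = {z \<in> biwords_R A. \<forall>p\<in>set z. - int m \<le> fst p}"
    unfolding set_subseqs_sorted_wrt[OF asymp_lt(2) sorted_list_R] set_list_R[OF A(2)] biwords_R_def by auto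
  have L: "{z. z \<in> set (subseqs (list_L A n m)) \<and> sum_list (map wt_L z) = k}
      = {z. z \<in> biwords_L A \<and> sum_list (map wt_L z) = k}"
  proof -
    have "1 - int m \<le> fst p" if "z \<in> biwords_L A" "sum_list (map wt_L z) = k" "p \<in> set z" for z p
      using c[of z p] that sorted_wrt_asymp_distinct[OF asymp_lt(1)]
      by (auto simp: biwords_L_def wt_L_def m_def)
    then show ?thesis unfolding subs_L by blast
  qed
  have R: "{z. z \<in> set (subseqs (list_R A n m)) \<and> sum_list (map wt_R z) = k}
      = {z. z \<in> biwords_R A \<and> sum_list (map wt_R z) = k}"
  proof -
    have "- int m \<le> fst p" if "z \<in> biwords_R A" "sum_list (map wt_R z) = k" "p \<in> set z" for z p
    proof -
      have "snd p \<in> A"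
        using that by (auto simp: biwords_R_def dom_R_def)
      then have "val (snd p) < int n"
        using A(2) val_less by blast
      then show ?thesis
        using d(2)[of z p] that sorted_wrt_asymp_distinct[OF asymp_lt(2)]
        by (auto simp: biwords_R_def wt_R_def m_def)
    qed
    then show ?thesis unfolding subs_R by blast
  qed
  have low: "fls_nth (prod_positions wt_R (list_R A n m)) j = 0" if "j < - d" for j
  proof -
    have "- d \<le> sum_list (map wt_R z)" if "z \<in> biwords_R A" for z
      using d(1)[of z] that sorted_wrt_asymp_distinct[OF asymp_lt(2)] by (simp add: biwords_R_def)
    then have none: "{z. z \<in> set (subseqs (list_R A n m)) \<and> sum_list (map wt_R z) = j} = {}"
      unfolding subs_R using \<open>j < - d\<close> by force
    show ?thesis
      unfolding factor_def nth_prod_list_one_plus_monom[OF dist(2)] none by simp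
  qed
  have "fls_nth (prod_positions wt_L (list_L A n m)) k
      = fls_nth ((1 + (stairs n 1 (int m) - 1)) * prod_positions wt_R (list_R A n m)) k"
    using prod_list_L_eq[OF A n] by simp
  also have "\<dots> = fls_nth (prod_positions wt_R (list_R A n m)) k"
    by (rule fls_nth_mult_one_plus[OF stairs_minus_one low]) (use n in \<open>auto simp: m_def\<close>)
  finally show ?thesis
    unfolding factor_def nth_prod_list_one_plus_monom[OF dist(1)] nth_prod_list_one_plus_monom[OF dist(2)] L R .
qed

end

section \<open>Word products in the id-Coxeter algebra\<close>

definition word_perm :: "nat list \<Rightarrow> int \<Rightarrow> int" where
  "word_perm js = foldr (\<lambda>j v. t_BC j \<circ> v) js id"

lemma word_perm_simps [simp]:
  "word_perm [] = id" "word_perm (j # js) = t_BC j \<circ> word_perm js"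
  by (simp_all add: word_perm_def)

lemma word_perm_append: "word_perm (js @ ks) = word_perm js \<circ> word_perm ks"
  by (induction js) auto

lemma t_BC_apply:
  "t_BC 0 x = (if x = 1 then - 1 else if x = - 1 then 1 else x)"
  "1 \<le> i \<Longrightarrow> t_BC i x = (if x = int i then int i + 1 else if x = int i + 1 then int i
     else if x = - int i then - int i - 1 else if x = - int i - 1 then - int i else x)"
  by (auto simp: t_BC_def transpose_def)

lemma t_BC_involution: "t_BC i \<circ> t_BC i = id"
  by (cases "i = 0") (auto simp: fun_eq_iff t_BC_apply)

lemma t_BC_uminus: "t_BC i (- x) = - t_BC i x"
  by (cases "i = 0") (auto simp: t_BC_apply)

lemma t_BC_far: "i + 2 \<le> j \<Longrightarrow> t_BC i \<circ> t_BC j = t_BC j \<circ> t_BC i"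
  by (cases "i = 0") (auto simp: fun_eq_iff t_BC_apply)

lemma t_BC_braid: "1 \<le> i \<Longrightarrow> t_BC i \<circ> (t_BC (Suc i) \<circ> t_BC i) = t_BC (Suc i) \<circ> (t_BC i \<circ> t_BC (Suc i))"
  by (auto simp: fun_eq_iff t_BC_apply)

lemma t_BC_neq: "i < j \<Longrightarrow> t_BC i \<noteq> t_BC j"
  by (rule notI, drule fun_cong[where x = "int j + 1"]) (cases "i = 0"; simp add: t_BC_apply)

lemma t_BC_in_W: "i < n \<Longrightarrow> t_BC i \<in> W_BC n"
  unfolding W_BC_def using t_BC_involution[of i]
  by (cases "i = 0") (auto simp: t_BC_uminus t_BC_apply intro!: o_bij[of "t_BC i"])

lemma W_BC_comp: "u \<in> W_BC n \<Longrightarrow> v \<in> W_BC n \<Longrightarrow> u \<circ> v \<in> W_BC n"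
  unfolding W_BC_def mem_Collect_eq by (intro conjI bij_comp) auto

lemma word_perm_in_W: "set js \<subseteq> {..<n} \<Longrightarrow> word_perm js \<in> W_BC n"
  by (induction js) (simp_all add: t_BC_in_W W_BC_comp, simp add: W_BC_def)

text \<open>Right multiplication by any generator negates this product, which yields the sign character of the group.\<close>

definition vandermonde_BC :: "nat \<Rightarrow> (int \<Rightarrow> int) \<Rightarrow> int" where
  "vandermonde_BC n v = (\<Prod>i\<in>{1..int n}. v i) *
     (\<Prod>(i, j)\<in>{(i, j). 1 \<le> i \<and> i < j \<and> j \<le> int n}. (v j)\<^sup>2 - (v i)\<^sup>2)"

lemma finite_index_pairs: "finite {(i, j). 1 \<le> i \<and> i < j \<and> j \<le> int n}"
  by (rule finite_subset[of _ "{1..int n} \<times> {1..int n}"]) auto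

text \<open>For \<open>i = 0\<close> only \<open>v 1\<close> changes sign, which the squares ignore.
  For \<open>i \<ge> 1\<close> the values at \<open>i\<close> and \<open>i + 1\<close> are swapped:
  the first product is permuted, and among the index pairs only \<open>(i, i + 1)\<close> is
  reversed.\<close>

lemma vandermonde_BC_t:
  assumes odd: "\<And>x. v (- x) = - v x" and "i < n"
  shows "vandermonde_BC n (v \<circ> t_BC i) = - vandermonde_BC n v"
proof (cases "i = 0")
  case True
  have "(\<Prod>i\<in>{1..int n}. (v \<circ> t_BC 0) i) = - (\<Prod>i\<in>{1..int n}. v i)"
  proof -
    have one: "1 \<in> {1..int n}" using assms(2) by simp
    have "(\<Prod>i\<in>{1..int n} - {1}. (v \<circ> t_BC 0) i) = (\<Prod>i\<in>{1..int n} - {1}. v i)"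
      by (rule prod.cong) (auto simp: t_BC_apply)
    then show ?thesis
      unfolding prod.remove[OF finite_atLeastAtMost_int one] using odd[of 1] by (simp add: t_BC_apply)
  qed
  moreover have "((v \<circ> t_BC 0) x)\<^sup>2 = (v x)\<^sup>2" for x
    using odd[of 1] by (simp add: t_BC_apply)
  ultimately show ?thesis
    using True by (simp add: vandermonde_BC_def del: comp_apply)
next
  case False
  then have i: "1 \<le> i" by simp
  define s where "s = transpose (int i) (int i + 1)"
  have s: "t_BC i x = s x" if "1 \<le> x" for x
    using that i by (auto simp: t_BC_apply s_def transpose_def)
  let ?Q = "{(i, j). 1 \<le> i \<and> i < j \<and> j \<le> int n}"
  let ?p = "(int i, int i + 1)"
  let ?f = "\<lambda>v. \<lambda>(i, j). (v j)\<^sup>2 - (v i :: int)\<^sup>2"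
  have pQ: "?p \<in> ?Q" using i assms(2) by auto
  have "(\<Prod>x\<in>{1..int n}. v (s x)) = (\<Prod>x\<in>{1..int n}. v x)"
    by (rule prod.reindex_bij_witness[of _ s s]) (use i assms(2) in \<open>auto simp: s_def transpose_def\<close>)
  then have 1: "(\<Prod>x\<in>{1..int n}. (v \<circ> t_BC i) x) = (\<Prod>x\<in>{1..int n}. v x)"
    using s by simp
  have "(\<Prod>q\<in>?Q - {?p}. ?f (v \<circ> t_BC i) q) = (\<Prod>q\<in>?Q - {?p}. ?f v q)"
  proof (rule prod.reindex_bij_witness[of _ "map_prod s s" "map_prod s s"])
    fix q assume q: "q \<in> ?Q - {?p}"
    show "map_prod s s (map_prod s s q) = q" by (cases q) (simp add: s_def)
    then show "map_prod s s (map_prod s s q) = q" .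
    show "map_prod s s q \<in> ?Q - {?p}" using q i assms(2) by (auto simp: s_def transpose_def split: if_splits)
    then show "map_prod s s q \<in> ?Q - {?p}" .
    show "?f v (map_prod s s q) = ?f (v \<circ> t_BC i) q" using q by (auto simp: s)
  qed
  moreover have "?f (v \<circ> t_BC i) ?p = - ?f v ?p"
    using i by (simp add: t_BC_apply)
  ultimately have 2: "(\<Prod>q\<in>?Q. ?f (v \<circ> t_BC i) q) = - (\<Prod>q\<in>?Q. ?f v q)"
    unfolding prod.remove[OF finite_index_pairs pQ] by (simp only: mult_minus_left)
  show ?thesis
    unfolding vandermonde_BC_def 1 2 by simp
qed

lemma vandermonde_BC_word_perm:
  assumes "set js \<subseteq> {..<n}"
  shows "vandermonde_BC n (word_perm js) = (- 1) ^ length js * vandermonde_BC n id"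
  using assms
proof (induction js rule: rev_induct)
  case (snoc j js)
  have "word_perm js (- x) = - word_perm js x" for x
    using word_perm_in_W[of js n] snoc.prems by (simp add: W_BC_def)
  then show ?case
    using snoc vandermonde_BC_t[of "word_perm js" j n] by (simp add: word_perm_append comp_def id_def)
qed simp

lemma vandermonde_BC_id_nonzero: "vandermonde_BC n id \<noteq> 0"
  unfolding vandermonde_BC_def
  using finite_index_pairs[of n] by (auto simp: prod_zero_iff power2_eq_iff)

lemma word_perm_parity:
  assumes "set js \<subseteq> {..<n}" "set ks \<subseteq> {..<n}" "word_perm js = word_perm ks"
  shows "even (length js) \<longleftrightarrow> even (length ks)"
proof -
  have "(- 1 :: int) ^ length js = (- 1) ^ length ks"
    using vandermonde_BC_word_perm[OF assms(1)] vandermonde_BC_word_perm[OF assms(2)] assms(3)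
      vandermonde_BC_id_nonzero[of n] by simp
  then show ?thesis
    by (cases "even (length js)"; cases "even (length ks)") auto
qed

section \<open>Coxeter lengths of products of generators\<close>

lemma length_BC_le: "set js \<subseteq> {..<n} \<Longrightarrow> length_BC n (word_perm js) \<le> length js"
  unfolding length_BC_def word_perm_def by (rule Least_le) blast

lemma reduced_word_exists:
  assumes "set js \<subseteq> {..<n}"
  obtains ks where "set ks \<subseteq> {..<n}" "word_perm ks = word_perm js" "length ks = length_BC n (word_perm js)"
proof -
  have "\<exists>ks. length ks = length_BC n (word_perm js) \<and> set ks \<subseteq> {..<n} \<and> word_perm js = foldr (\<lambda>j v. t_BC j \<circ> v) ks id"
    unfolding length_BC_def
    by (rule LeastI[of _ "length js"]) (use assms in \<open>unfold word_perm_def, blast\<close>)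
  then show thesis using that by (auto simp: word_perm_def)
qed

text \<open>Prepending \<open>j\<close> to reduced words shows that the lengths differ by at most
  one, since \<open>t_BC j\<close> is an involution; equality is excluded by parity.\<close>

lemma length_BC_t_step:
  assumes "set js \<subseteq> {..<n}" "j < n"
  shows "length_BC n (t_BC j \<circ> word_perm js) = Suc (length_BC n (word_perm js))
       \<or> length_BC n (word_perm js) = Suc (length_BC n (t_BC j \<circ> word_perm js))"
proof -
  obtain ks where ks: "set ks \<subseteq> {..<n}" "word_perm ks = word_perm js" "length ks = length_BC n (word_perm js)"
    using reduced_word_exists[OF assms(1)] .
  have js: "set (j # js) \<subseteq> {..<n}" using assms by simp
  obtain ls where ls: "set ls \<subseteq> {..<n}" "word_perm ls = word_perm (j # js)"
      "length ls = length_BC n (word_perm (j # js))"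
    using reduced_word_exists[OF js] .
  have cancel: "word_perm (j # ls) = word_perm js"
    using ls(2) t_BC_involution[of j] by (simp add: comp_assoc[symmetric])
  have "length ls \<le> Suc (length ks)"
    using length_BC_le[of "j # ks" n] ks ls assms(2) by simp
  moreover have "length ks \<le> Suc (length ls)"
    using length_BC_le[of "j # ls" n] cancel ks ls assms(2) by simp
  moreover have "even (length (j # ks)) \<longleftrightarrow> even (length ls)"
    by (rule word_perm_parity[of _ n]) (use ks ls assms in auto)
  ultimately have "length ls = Suc (length ks) \<or> length ks = Suc (length ls)"
    by (simp, presburger)
  then show ?thesis
    using ks(3) ls(3) by simp
qed

lemma length_BC_id: "length_BC n id = 0"
  using length_BC_le[of "[]" n] by simp

lemma length_BC_t: "j < n \<Longrightarrow> length_BC n (t_BC j) = 1"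
  using length_BC_t_step[of "[]" n j] by (simp add: length_BC_id)

lemma length_BC_0: "set js \<subseteq> {..<n} \<Longrightarrow> length_BC n (word_perm js) = 0 \<Longrightarrow> word_perm js = id"
  by (rule reduced_word_exists[of js n]) auto

lemma length_BC_1:
  assumes "set js \<subseteq> {..<n}" "length_BC n (word_perm js) = 1"
  obtains j where "j < n" "word_perm js = t_BC j"
proof -
  obtain ks where ks: "set ks \<subseteq> {..<n}" "word_perm ks = word_perm js" "length ks = length_BC n (word_perm js)"
    using reduced_word_exists[OF assms(1)] .
  then obtain k where "ks = [k]"
    using assms(2) by (auto simp: length_Suc_conv)
  then show thesis
    using ks that[of k] by simp
qed

text \<open>The only alternative is length 0, which would make the two generators equal.\<close>

lemma length_BC_t_t:
  assumes "i < n" "j < n" "i \<noteq> j"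
  shows "length_BC n (t_BC i \<circ> t_BC j) = 2"
proof (rule ccontr)
  assume "length_BC n (t_BC i \<circ> t_BC j) \<noteq> 2"
  then have "length_BC n (word_perm [i, j]) = 0"
    using length_BC_t_step[of "[j]" n i] length_BC_t[of j n] assms by simp
  then have "t_BC i \<circ> t_BC j = id"
    using length_BC_0[of "[i, j]" n] assms by simp
  then have "t_BC i = t_BC j"
    using t_BC_involution[of j] by (metis comp_assoc comp_id id_comp)
  then show False
    using t_BC_neq[of i j] t_BC_neq[of j i] assms(3) by (metis nat_neq_iff)
qed

text \<open>The only alternative is length 1, but the product maps \<open>i\<close> to
  \<open>i + 2\<close> and no generator does so.\<close>

lemma length_BC_braid:
  assumes "1 \<le> i" "Suc i < n"
  shows "length_BC n (t_BC i \<circ> (t_BC (Suc i) \<circ> t_BC i)) = 3"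
proof (rule ccontr)
  assume "length_BC n (t_BC i \<circ> (t_BC (Suc i) \<circ> t_BC i)) \<noteq> 3"
  then have "length_BC n (word_perm [i, Suc i, i]) = 1"
    using length_BC_t_step[of "[Suc i, i]" n i] length_BC_t_t[of "Suc i" n i] assms by simp
  then obtain j where "t_BC i \<circ> (t_BC (Suc i) \<circ> t_BC i) = t_BC j"
    using length_BC_1[of "[i, Suc i, i]" n] assms by auto
  then have "t_BC j (int i) = int i + 2"
    using assms by (auto simp: fun_eq_iff t_BC_apply dest!: spec[of _ "int i"])
  then show False
    using assms by (cases "j = 0") (auto simp: t_BC_apply split: if_splits)
qed

section \<open>Word products and their coordinates\<close>

context id_coxeter_algebra
begin

text \<open>Letters outside the alphabet act as \<open>0\<close>, so that the relations hold for all indices.\<close>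

definition gen :: "nat \<Rightarrow> 'h" where
  "gen j = (if j < n then \<pi> (t_BC j) else 0)"

lemma gen_mult_t:
  assumes "set js \<subseteq> {..<n}" "j < n" "length_BC n (t_BC j \<circ> word_perm js) = Suc (length_BC n (word_perm js))"
  shows "gen j * \<pi> (word_perm js) = \<pi> (t_BC j \<circ> word_perm js)"
  using assms basis_mult[of "t_BC j" "word_perm js"] by (simp add: gen_def t_BC_in_W word_perm_in_W length_BC_t)

lemma gen_square: "gen j * gen j = smul \<beta> (gen j)"
  using basis_simple_square by (simp add: gen_def)

text \<open>Inside the range of generators, additivity of length turns both sides of the commutation
  and braid relations into \<open>\<pi>\<close> of one group element; outside it, both sides
  vanish.\<close>

lemma gen_relations: "hecke_relations gen (smul \<beta> 1)"
proof
  show "smul \<beta> 1 * u = u * smul \<beta> 1" for u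
    by (simp add: smul_mult_left smul_mult_right)
  show "gen j * gen j = smul \<beta> 1 * gen j" for j
    by (simp add: gen_square smul_mult_left)
next
  have two: "gen i * gen j = \<pi> (t_BC i \<circ> t_BC j)" if "i < n" "j < n" "i \<noteq> j" for i j
    using gen_mult_t[of "[j]" i] that by (simp add: length_BC_t_t length_BC_t gen_def)
  show "gen j * gen k = gen k * gen j" if "j + 2 \<le> k" for j k
  proof (cases "k < n")
    case True
    then show ?thesis using two[of j k] two[of k j] that t_BC_far[OF that] by simp
  qed (simp add: gen_def)
  show "gen k * (gen (Suc k) * gen k) = gen (Suc k) * (gen k * gen (Suc k))" if "1 \<le> k" for k
  proof (cases "Suc k < n")
    case True
    then show ?thesis
      using gen_mult_t[of "[Suc k, k]" k] gen_mult_t[of "[k, Suc k]" "Suc k"] that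
      by (simp add: two length_BC_t_t length_BC_braid t_BC_braid[symmetric])
  qed (simp add: gen_def)
qed

text \<open>A word product is a power of \<open>\<beta>\<close> times one basis element. A new
  letter \<open>j\<close> either lengthens the permutation \<open>v\<close>, or
  \<open>\<pi> v = gen j * \<pi> (t_BC j \<circ> v)\<close> and the quadratic relation yields a
  factor \<open>\<beta>\<close>.\<close>

lemma word_product:
  assumes "set js \<subseteq> {..<n}"
  obtains ks where "set ks \<subseteq> {..<n}" "length_BC n (word_perm ks) \<le> length js"
    "prod_list (map gen js) = smul (\<beta> ^ (length js - length_BC n (word_perm ks))) (\<pi> (word_perm ks))"
  using assms
proof (induction js arbitrary: thesis)
  case Nil
  show ?case
    by (rule Nil(1)[of "[]"]) (simp_all only: word_perm_simps length_BC_id basis_id list.map prod_list.Nil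
        list.size list.set empty_subsetI order_refl diff_self_eq_0 power_0 scale_one)
next
  case (Cons j js)
  from Cons.prems(2) have j: "j < n" "set js \<subseteq> {..<n}" by auto
  obtain ks where ks: "set ks \<subseteq> {..<n}" "length_BC n (word_perm ks) \<le> length js"
    "prod_list (map gen js) = smul (\<beta> ^ (length js - length_BC n (word_perm ks))) (\<pi> (word_perm ks))"
    using Cons.IH[OF _ j(2)] by blast
  consider "length_BC n (t_BC j \<circ> word_perm ks) = Suc (length_BC n (word_perm ks))"
    | "length_BC n (word_perm ks) = Suc (length_BC n (t_BC j \<circ> word_perm ks))"
    using length_BC_t_step[OF ks(1) j(1)] by blast
  then show ?case
  proof cases
    case 1
    then show ?thesis
      using Cons.prems(1)[of "j # ks"] ks j gen_mult_t[OF ks(1) j(1)] unfolding word_perm_simps(2)[symmetric]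
      by (simp add: smul_mult_right del: word_perm_simps)
  next
    case 2
    have cancel: "t_BC j \<circ> (t_BC j \<circ> word_perm ks) = word_perm ks"
      by (simp add: comp_assoc[symmetric] t_BC_involution)
    then have "gen j * \<pi> (t_BC j \<circ> word_perm ks) = \<pi> (word_perm ks)"
      using gen_mult_t[of "j # ks" j] ks j 2 by simp
    then have "gen j * \<pi> (word_perm ks) = smul \<beta> (\<pi> (word_perm ks))"
      by (metis gen_square mult.assoc smul_mult_left)
    then have "prod_list (map gen (j # js))
        = smul (\<beta> ^ (length (j # js) - length_BC n (word_perm ks))) (\<pi> (word_perm ks))"
      using ks by (simp add: smul_mult_right Suc_diff_le mult.commute)
    then show ?thesis
      using Cons.prems(1)[of ks] ks by simp
  qed
qed

definition basis_coeff :: "(int \<Rightarrow> int) \<Rightarrow> 'h \<Rightarrow> int poly" where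
  "basis_coeff w x = representation (\<pi> ` W_BC n) x (\<pi> w)"

text \<open>By \<open>word_product\<close> only one coordinate of a word product can be nonzero.
  Hence the coordinate at \<open>\<pi> w\<close> of a sum over all words singles out the Hecke words
  together with their powers of \<open>\<beta>\<close>.\<close>

lemma basis_coeff_word:
  assumes "set a \<subseteq> A" "A \<subseteq> alphabet_C n" "w \<in> W_BC n"
  shows "prod_list (map (\<lambda>c. gen (absv c)) a) \<in> span (\<pi> ` W_BC n)"
    and "basis_coeff w (prod_list (map (\<lambda>c. gen (absv c)) a))
      = (if a \<in> hecke_words A smul n \<pi> w then \<beta> ^ (length a - length_BC n w) else 0)"
proof -
  have lt: "absv c < n" if "c \<in> set a" for c
    using that assms by (auto simp: alphabet_C_def)
  then have "set (map absv a) \<subseteq> {..<n}" by auto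
  then obtain ks where ks: "set ks \<subseteq> {..<n}" "length_BC n (word_perm ks) \<le> length a"
    "prod_list (map gen (map absv a)) = smul (\<beta> ^ (length a - length_BC n (word_perm ks))) (\<pi> (word_perm ks))"
    using word_product[of "map absv a"] by auto
  define v where "v = word_perm ks"
  have v: "v \<in> W_BC n" using word_perm_in_W ks(1) by (simp add: v_def)
  have prod: "prod_list (map (\<lambda>c. gen (absv c)) a) = smul (\<beta> ^ (length a - length_BC n v)) (\<pi> v)"
    using ks(3) by (simp add: comp_def v_def)
  have bas: "\<pi> v \<in> span (\<pi> ` W_BC n)"
    using v by (intro span_base) auto
  then show "prod_list (map (\<lambda>c. gen (absv c)) a) \<in> span (\<pi> ` W_BC n)"
    unfolding prod by (rule span_scale)
  have coeff: "basis_coeff w (smul c (\<pi> u)) = (if u = w then c else 0)" if "u \<in> W_BC n" for c u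
    using that assms(3) basis_inj
    by (auto simp: basis_coeff_def representation_scale[OF basis_independent span_base]
        representation_basis[OF basis_independent] dest: inj_onD)
  have "prod_list (map (\<lambda>c. gen (absv c)) a) = prod_list (map (\<lambda>c. \<pi> (t_BC (absv c))) a)"
    using lt by (intro arg_cong[where f = prod_list] map_cong) (auto simp: gen_def)
  then have mem: "a \<in> hecke_words A smul n \<pi> w \<longleftrightarrow> length_BC n w \<le> length a
      \<and> smul (\<beta> ^ (length a - length_BC n v)) (\<pi> v) = smul (\<beta> ^ (length a - length_BC n w)) (\<pi> w)"
    using assms(1) prod by (simp add: hecke_words_def)
  show "basis_coeff w (prod_list (map (\<lambda>c. gen (absv c)) a))
      = (if a \<in> hecke_words A smul n \<pi> w then \<beta> ^ (length a - length_BC n w) else 0)"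
  proof (cases "a \<in> hecke_words A smul n \<pi> w")
    case True
    then show ?thesis using mem prod coeff[OF assms(3)] by simp
  next
    case False
    then have "v \<noteq> w" using mem ks(2) v_def by auto
    then show ?thesis using False prod coeff[OF v] by simp
  qed
qed

lemma basis_coeff_sum:
  "(\<And>x. x \<in> S \<Longrightarrow> f x \<in> span (\<pi> ` W_BC n)) \<Longrightarrow> basis_coeff w (\<Sum>x\<in>S. f x) = (\<Sum>x\<in>S. basis_coeff w (f x))"
  unfolding basis_coeff_def by (simp add: representation_sum[OF basis_independent])

lemma hecke_biword_sums_eq:
  assumes A: "alphabet_B n \<subseteq> A" "A \<subseteq> alphabet_C n" and n: "n \<ge> 1" and w: "w \<in> W_BC n"
  defines "H \<equiv> hecke_words A smul n \<pi> w"
  shows "(\<Sum>z | z \<in> biwords_L A \<and> map snd z \<in> H \<and> sum_list (map wt_L z) = k. \<beta> ^ (length z - length_BC n w))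
       = (\<Sum>z | z \<in> biwords_R A \<and> map snd z \<in> H \<and> sum_list (map wt_R z) = k. \<beta> ^ (length z - length_BC n w))"
proof -
  interpret hecke_relations gen "smul \<beta> 1" by (rule gen_relations)
  have sum: "basis_coeff w (\<Sum>z | z \<in> Z \<and> sum_list (map wt z) = k. prod_list (map (\<lambda>p. gen (absv (snd p))) z))
      = (\<Sum>z | z \<in> Z \<and> map snd z \<in> H \<and> sum_list (map wt z) = k. \<beta> ^ (length z - length_BC n w))"
    if Z: "\<And>z. z \<in> Z \<Longrightarrow> snd ` set z \<subseteq> A" and fin: "finite {z \<in> Z. sum_list (map wt z) \<le> k}"
    for Z and wt :: "position \<Rightarrow> int"
  proof -
    have word: "prod_list (map (\<lambda>p. gen (absv (snd p))) z) \<in> span (\<pi> ` W_BC n)"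
      "basis_coeff w (prod_list (map (\<lambda>p. gen (absv (snd p))) z))
        = (if map snd z \<in> H then \<beta> ^ (length z - length_BC n w) else 0)" if "z \<in> Z" for z
      using basis_coeff_word[of "map snd z" A w] Z[OF that] A(2) w by (simp_all add: comp_def H_def)
    have "finite {z \<in> Z. sum_list (map wt z) = k}"
      using fin by (rule rev_finite_subset) auto
    then show ?thesis
      by (subst basis_coeff_sum) (auto simp: word intro!: sum.mono_neutral_cong_right split: if_splits)
  qed
  have L: "snd ` set z \<subseteq> A" if "z \<in> biwords_L A" for z
    using that by (auto simp: biwords_L_def dom_L_def)
  have R: "snd ` set z \<subseteq> A" if "z \<in> biwords_R A" for z
    using that by (auto simp: biwords_R_def dom_R_def)
  show ?thesis
    using arg_cong[OF biword_sums_eq[OF A n, of k], of "basis_coeff w"]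
      sum[of "biwords_L A" wt_L, OF L finite_biwords(1)[OF A(2)]]
      sum[of "biwords_R A" wt_R, OF R finite_biwords(2)[OF A(2)]] by simp
qed

end

section \<open>Expansion of the summands\<close>

text \<open>These are P-partitions: the parts \<open>- fst p\<close> are positive, weakly decreasing
  with sum \<open>k\<close>, and strictly decreasing wherever \<open>a\<close> has no ascent for
  \<open>\<prec>\<close>.\<close>

definition fillings :: "letter list \<Rightarrow> int \<Rightarrow> position list set" where
  "fillings a k = {z. sorted_wrt lt_R z \<and> (\<forall>p\<in>set z. fst p \<le> - 1) \<and> map snd z = a
     \<and> (\<Sum>p\<leftarrow>z. - fst p) = k}"

lemma sum_list_nonneg_fillings: "\<forall>p\<in>set z. fst p \<le> - 1 \<Longrightarrow> 0 \<le> (\<Sum>p\<leftarrow>z. - fst p :: int)"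
  by (induction z) auto

lemma fillings_neg: "k < 0 \<Longrightarrow> fillings a k = {}"
  using sum_list_nonneg_fillings by (fastforce simp: fillings_def)

lemma finite_fillings: "finite (fillings a k)"
proof (rule finite_subset)
  let ?Q = "{p :: position. snd p \<in> set a \<and> fst p \<le> - 1}"
  have fin: "finite {p \<in> ?Q. - fst p \<le> K}" for K
    by (rule finite_subset[of _ "{- K..- 1} \<times> set a"]) auto
  show "finite {z. distinct z \<and> set z \<subseteq> ?Q \<and> (\<Sum>p\<leftarrow>z. - fst p) \<le> k}"
    by (rule finite_distinct_lists_weight[OF fin])
  show "fillings a k \<subseteq> {z. distinct z \<and> set z \<subseteq> ?Q \<and> (\<Sum>p\<leftarrow>z. - fst p) \<le> k}"
    using sorted_wrt_asymp_distinct[OF asymp_lt(2)] by (force simp: fillings_def)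
qed

definition shift :: "position list \<Rightarrow> position list" where
  "shift z = map (\<lambda>p. (fst p - 1, snd p)) z"

lemma inj_shift: "inj shift"
  unfolding shift_def by (rule inj_mapI) (auto intro!: injI simp: prod_eq_iff)

text \<open>Fillings with all parts at least 2 arise by adding 1 to each part, which raises the sum
  by the length of the word.\<close>

lemma shift_fillings:
  "shift ` fillings a (k - int (length a)) = {z \<in> fillings a k. \<forall>p\<in>set z. fst p \<le> - 2}"
proof -
  have sorted: "sorted_wrt lt_R (shift z) \<longleftrightarrow> sorted_wrt lt_R z" for z
    unfolding shift_def sorted_wrt_map by (simp add: lt_R_def[abs_def])
  have snd: "map snd (shift z) = map snd z" for z
    by (simp add: shift_def comp_def)
  have wt: "(\<Sum>p\<leftarrow>shift z. - fst p) = (\<Sum>p\<leftarrow>z. - fst p) + int (length z)" for z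
    by (induction z) (auto simp: shift_def)
  have bound: "(\<forall>p\<in>set (shift z). fst p \<le> - 2) \<longleftrightarrow> (\<forall>p\<in>set z. fst p \<le> - 1)" for z
    by (auto simp: shift_def)
  have surj: "z = shift (map (\<lambda>p. (fst p + 1, snd p)) z)" for z
    by (simp add: shift_def comp_def)
  have len: "length z = length a" if "map snd z = a" for z
    using that by auto
  show ?thesis
  proof (intro equalityI subsetI)
    fix y assume "y \<in> shift ` fillings a (k - int (length a))"
    then obtain z where z: "y = shift z" "z \<in> fillings a (k - int (length a))" by auto
    then have "\<forall>p\<in>set y. fst p \<le> - 2" using bound[of z] by (simp add: fillings_def)
    then show "y \<in> {z \<in> fillings a k. \<forall>p\<in>set z. fst p \<le> - 2}"
      using z len[of z] by (auto simp: fillings_def sorted snd wt)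
  next
    fix y assume y: "y \<in> {z \<in> fillings a k. \<forall>p\<in>set z. fst p \<le> - 2}"
    define z where "z = map (\<lambda>p. (fst p + 1, snd p)) y"
    have yz: "y = shift z" unfolding z_def by (rule surj)
    have "z \<in> fillings a (k - int (length a))"
      using y bound[of z] len[of z] unfolding yz by (simp add: fillings_def sorted snd wt)
    then show "y \<in> shift ` fillings a (k - int (length a))"
      unfolding yz by simp
  qed
qed

lemma sorted_wrt_last:
  assumes "sorted_wrt R z" "p \<in> set z"
  shows "p = last z \<or> R p (last z)"
  using assms by (cases z rule: rev_cases) (auto simp: sorted_wrt_append)

text \<open>Split by whether the last, largest index is below or equal to \<open>- 1\<close>.\<close>

lemma fillings_snoc:
  "fillings (a @ [c]) k = shift ` fillings (a @ [c]) (k - int (Suc (length a))) \<union>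
     (\<lambda>z. z @ [(- 1, c)]) ` (if a = [] \<or> letter_prec (last a) c then fillings a (k - 1)
       else shift ` fillings a (k - 1 - int (length a)))"
  (is "_ = ?S \<union> ?T")
proof -
  let ?asc = "a = [] \<or> letter_prec (last a) c"
  have S: "?S = {z \<in> fillings (a @ [c]) k. \<forall>p\<in>set z. fst p \<le> - 2}"
    using shift_fillings[of "a @ [c]" k] by simp
  \<comment> \<open>Only the last, largest entry of \<open>z\<close> is critical: if its index is
    already \<open>- 1\<close>, the letter \<open>c\<close> must come after \<open>last a\<close> in
    the order \<open>\<prec>\<close>.\<close>
  have below: "(\<forall>p\<in>set z. lt_R p (- 1, c)) \<longleftrightarrow> ?asc \<or> (\<forall>p\<in>set z. fst p \<le> - 2)"
    if z: "z \<in> fillings a j" for z j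
  proof -
    have props: "sorted_wrt lt_R z" "\<forall>p\<in>set z. fst p \<le> - 1" "map snd z = a"
      using z by (auto simp: fillings_def)
    show ?thesis
    proof (cases "z = []")
      case True
      then show ?thesis using props by simp
    next
      case False
      then have last: "last z \<in> set z" "snd (last z) = last a" "a \<noteq> []"
        using props(3) by (auto simp: last_map)
      have l: "fst p < fst (last z) \<or> fst p = fst (last z) \<and> rank_prec (snd p) \<le> rank_prec (last a)"
        if "p \<in> set z" for p
        using sorted_wrt_last[OF props(1) that] last(2) by (auto simp: lt_R_def)
      have le: "fst p \<le> - 1" if "p \<in> set z" for p using props(2) that by blast
      show ?thesis
      proof
        assume "\<forall>p\<in>set z. lt_R p (- 1, c)"
        then have "fst (last z) \<le> - 2 \<or> letter_prec (last a) c"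
          using last by (auto simp: lt_R_def letter_prec_def)
        then show "?asc \<or> (\<forall>p\<in>set z. fst p \<le> - 2)"
          using l by force
      next
        assume R: "?asc \<or> (\<forall>p\<in>set z. fst p \<le> - 2)"
        show "\<forall>p\<in>set z. lt_R p (- 1, c)"
        proof
          fix p assume p: "p \<in> set z"
          show "lt_R p (- 1, c)"
          proof (cases "fst p \<le> - 2")
            case False
            then have "letter_prec (last a) c" "fst p = - 1"
              using R p last(3) le[OF p] by auto
            then show ?thesis
              using l[OF p] le[OF last(1)] by (auto simp: lt_R_def letter_prec_def)
          qed (simp add: lt_R_def)
        qed
      qed
    qed
  qed
  have T: "?T = {z @ [(- 1, c)] | z. z \<in> fillings a (k - 1) \<and> (\<forall>p\<in>set z. lt_R p (- 1, c))}"
    unfolding shift_fillings using below by auto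
  have "z \<in> fillings (a @ [c]) k \<longleftrightarrow> z \<in> ?S \<or> z \<in> ?T" for z
  proof
    assume z: "z \<in> fillings (a @ [c]) k"
    then have "map snd z = a @ [c]" by (simp add: fillings_def)
    then obtain z' i where z': "z = z' @ [(i, c)]" "map snd z' = a"
      by (cases z rule: rev_cases) auto
    have "i \<le> - 1" using z z' by (simp add: fillings_def)
    then consider "i \<le> - 2" | "i = - 1" by linarith
    then show "z \<in> ?S \<or> z \<in> ?T"
    proof cases
      case 1
      have "fst p \<le> - 2" if "p \<in> set z" for p
        using 1 that z z' by (fastforce simp: fillings_def sorted_wrt_append lt_R_def)
      then show ?thesis unfolding S using z by blast
    next
      case 2
      then show ?thesis
        unfolding T using z z' by (auto simp: fillings_def sorted_wrt_append)
    qed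
  next
    assume "z \<in> ?S \<or> z \<in> ?T"
    then show "z \<in> fillings (a @ [c]) k"
      unfolding S T by (auto simp: fillings_def sorted_wrt_append)
  qed
  then show ?thesis by blast
qed

lemma card_fillings_snoc:
  "card (fillings (a @ [c]) k) = card (fillings (a @ [c]) (k - int (Suc (length a)))) +
     card (fillings a (k - 1 - (if a = [] \<or> letter_prec (last a) c then 0 else int (length a))))"
proof -
  let ?S = "shift ` fillings (a @ [c]) (k - int (Suc (length a)))"
  let ?T = "if a = [] \<or> letter_prec (last a) c then fillings a (k - 1)
       else shift ` fillings a (k - 1 - int (length a))"
  have inj: "inj_on shift Z" for Z
    by (rule inj_on_subset[OF inj_shift]) simp
  have "?S \<inter> (\<lambda>z. z @ [(- 1, c)]) ` ?T = {}"
    using shift_fillings[of "a @ [c]" k] by auto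
  moreover have "card ((\<lambda>z. z @ [(- 1, c)]) ` ?T) = card ?T"
    by (rule card_image) (simp add: inj_on_def)
  ultimately show ?thesis
    unfolding fillings_snoc[of a c k] by (simp add: card_Un_disjoint finite_fillings card_image inj)
qed

section \<open>Generating series of fillings\<close>

definition fillings_series :: "letter list \<Rightarrow> qseries" where
  "fillings_series a = Abs_fls (\<lambda>k. of_nat (card (fillings a k)))"

lemma fillings_series_nth [simp]: "fls_nth (fillings_series a) k = of_nat (card (fillings a k))"
  unfolding fillings_series_def by (rule nth_Abs_fls_lower_bound[of 0]) (simp add: fillings_neg)

lemma nth_fls_monom_mult [simp]: "fls_nth (fls_monom e 1 * f) k = fls_nth (f :: 'a::ring_1 fls) (k - e)"
  by (simp add: fls_monom_def fls_shifted_times_simps)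

lemma qvar_conv_monom: "qvar powi m = fls_monom (- m) 1" "qvar ^ i = fls_monom (- int i) 1"
proof -
  show "qvar powi m = fls_monom (- m) 1" for m
    unfolding qvar_def power_int_inverse fls_X_power_int fls_inverse_X_intpow by (simp add: fls_monom_def)
  from this[of "int i"] show "qvar ^ i = fls_monom (- int i) 1"
    by simp
qed

lemma fillings_series_snoc:
  "fillings_series (a @ [c]) = fls_monom (int (Suc (length a))) 1 * fillings_series (a @ [c])
     + fls_monom (1 + (if a = [] \<or> letter_prec (last a) c then 0 else int (length a))) 1 * fillings_series a"
  by (rule fls_eqI) (subst fillings_series_nth, subst card_fillings_snoc, simp add: diff_diff_eq)

lemma comaj_BC_snoc:
  "comaj_BC (a @ [c]) = comaj_BC a + (if a = [] \<or> letter_prec (last a) c then length a else 0)"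
proof -
  let ?P = "\<lambda>a. {i. 1 \<le> i \<and> i < length a \<and> letter_prec (a ! (i - 1)) (a ! i)}"
  have "?P (a @ [c]) = ?P a \<union> (if a \<noteq> [] \<and> letter_prec (last a) c then {length a} else {})"
    by (cases "a = []") (auto simp: nth_append less_Suc_eq last_conv_nth Suc_le_eq)
  moreover have "finite (?P a)" by simp
  ultimately show ?thesis
    by (auto simp: comaj_BC_def)
qed

text \<open>With \<open>N\<close> the new length, the recurrence says that \<open>1 - X^N\<close>
  times the new series is \<open>X^(1 + e)\<close> times the old one. Multiplied by
  \<open>q^N\<close> this leaves \<open>q^(N - 1 - e)\<close>, and \<open>N - 1 - e\<close> is the
  increment of \<open>comaj_BC\<close>.\<close>

lemma fillings_series_eq:
  "fillings_series a * (\<Prod>i = 1..length a. (qvar ^ i - 1)) = qvar powi int (comaj_BC a)"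
proof (induction a rule: rev_induct)
  case Nil
  have "fillings [] k = (if k = 0 then {[]} else {})" for k
    by (auto simp: fillings_def)
  then have "fillings_series [] = 1"
    by (intro fls_eqI) simp
  then show ?case by (simp add: comaj_BC_def)
next
  case (snoc c a)
  let ?e = "if a = [] \<or> letter_prec (last a) c then 0 else int (length a)"
  let ?N = "int (Suc (length a))"
  let ?G = "fillings_series (a @ [c])"
  have "?G * (qvar ^ Suc (length a) - 1) = fls_monom (- ?N) 1 * (?G - fls_monom ?N 1 * ?G)"
  proof -
    have "fls_monom (- ?N) 1 * (fls_monom ?N 1 * ?G) = ?G"
      by (simp add: mult.assoc[symmetric] fls_monom_mult)
    then show ?thesis
      by (simp add: qvar_conv_monom right_diff_distrib left_diff_distrib mult.commute del: power_Suc)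
  qed
  also have "?G - fls_monom ?N 1 * ?G = fls_monom (1 + ?e) 1 * fillings_series a"
    using fillings_series_snoc[of a c] by (simp only: diff_eq_eq add.commute)
  also have "fls_monom (- ?N) 1 * (fls_monom (1 + ?e) 1 * fillings_series a)
      = qvar powi (int (length a) - ?e) * fillings_series a"
    by (simp add: mult.assoc[symmetric] fls_monom_mult qvar_conv_monom algebra_simps)
  finally have step: "?G * (qvar ^ Suc (length a) - 1) = qvar powi (int (length a) - ?e) * fillings_series a" .
  have "?G * (\<Prod>i = 1..length (a @ [c]). (qvar ^ i - 1))
      = (\<Prod>i = 1..length a. (qvar ^ i - 1)) * (?G * (qvar ^ Suc (length a) - 1))"
    by (simp add: prod.nat_ivl_Suc' mult_ac del: power_Suc)
  also have "\<dots> = qvar powi (int (length a) - ?e) * qvar powi int (comaj_BC a)"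
    unfolding step snoc.IH[symmetric] by (simp add: mult_ac)
  also have "\<dots> = qvar powi int (comaj_BC (a @ [c]))"
    by (simp add: qvar_conv_monom fls_monom_mult comaj_BC_snoc algebra_simps)
  finally show ?case .
qed

lemma Sigma_BC_sum_list: "Sigma_BC a = (\<Sum>c\<leftarrow>a. max 0 (val c))"
proof -
  have "(\<Sum>c\<leftarrow>a. max 0 (val c)) = (\<Sum>j<length a. max 0 (val (a ! j)))"
    by (simp add: sum_list_sum_nth atLeast0LessThan)
  also have "\<dots> = Sigma_BC a"
    unfolding Sigma_BC_def by (rule sum.mono_neutral_cong_right) auto
  finally show ?thesis by simp
qed

lemma nth_word_term:
  assumes "set a \<subseteq> A"
  shows "fls_nth (coef b / (\<Prod>i = 1..length a. (qvar ^ i - 1)) * qvar powi (Sigma_BC a + int (comaj_BC a))) k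
       = (\<Sum>z | z \<in> biwords_R A \<and> map snd z = a \<and> sum_list (map wt_R z) = k. to_fract b)"
proof -
  define D where "D = (\<Prod>i = 1..length a. (qvar ^ i - 1))"
  have eq: "fillings_series a * D = qvar powi int (comaj_BC a)"
    unfolding D_def by (rule fillings_series_eq)
  have "qvar powi int (comaj_BC a) \<noteq> 0"
    by (simp add: qvar_def)
  \<comment> \<open>A multiple of \<open>D\<close> is a power of \<open>q\<close>, so division by
    \<open>D\<close> is genuine.\<close>
  then have "D \<noteq> 0" using eq by auto
  then have ser: "qvar powi int (comaj_BC a) / D = fillings_series a"
    unfolding eq[symmetric] by simp
  have "qvar powi (Sigma_BC a + int (comaj_BC a)) = qvar powi Sigma_BC a * qvar powi int (comaj_BC a)"
    by (simp add: qvar_conv_monom fls_monom_mult)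
  then have "coef b / D * qvar powi (Sigma_BC a + int (comaj_BC a))
      = coef b * (fls_monom (- Sigma_BC a) 1 * fillings_series a)"
    unfolding ser[symmetric] by (simp add: qvar_conv_monom)
  moreover have "{z. z \<in> biwords_R A \<and> map snd z = a \<and> sum_list (map wt_R z) = k} = fillings a (k + Sigma_BC a)"
  proof -
    have wt: "sum_list (map wt_R z) = (\<Sum>p\<leftarrow>z. - fst p) - (\<Sum>c\<leftarrow>map snd z. max 0 (val c))" for z
      by (induction z) (auto simp: wt_R_def)
    have "z \<in> biwords_R A \<and> map snd z = a \<and> sum_list (map wt_R z) = k \<longleftrightarrow> z \<in> fillings a (k + Sigma_BC a)" for z
    proof (cases "map snd z = a")
      case True
      have "snd p \<in> A" if "p \<in> set z" for p
        using assms that True[symmetric] by auto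
      then have dom: "set z \<subseteq> dom_R A \<longleftrightarrow> (\<forall>p\<in>set z. fst p \<le> - 1)"
        by (auto simp: dom_R_def)
      have "sum_list (map wt_R z) = k \<longleftrightarrow> (\<Sum>p\<leftarrow>z. - fst p) = k + Sigma_BC a"
        unfolding wt True Sigma_BC_sum_list by linarith
      then show ?thesis
        unfolding biwords_R_def fillings_def mem_Collect_eq dom using True by blast
    qed (simp add: fillings_def)
    then show ?thesis by blast
  qed
  ultimately show ?thesis
    unfolding D_def[symmetric]
    by (simp only: coef_def fls_mult_const_nth nth_fls_monom_mult fillings_series_nth sum_constant)
      (simp add: mult.commute)
qed

section \<open>Convergence and specialization\<close>

text \<open>The distance is 2 to minus the order of the difference, once that order is positive;
  agreement up to a high degree therefore makes it small.\<close>

lemma dist_fls_small: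
  fixes S :: "'a::group_add fls"
  assumes "0 < \<epsilon>"
  obtains K where "\<And>T. (\<And>j. j \<le> K \<Longrightarrow> fls_nth T j = fls_nth S j) \<Longrightarrow> dist T S < \<epsilon>"
proof -
  obtain N where N: "(1 / 2) ^ N < \<epsilon>"
    using real_arch_pow_inv[OF assms, of "1 / 2"] by auto
  have "dist T S < \<epsilon>" if T: "\<And>j. j \<le> int N \<Longrightarrow> fls_nth T j = fls_nth S j" for T
  proof (cases "T = S")
    case False
    then have "T - S \<noteq> 0" by simp
    then have "fls_nth (T - S) (fls_subdegree (T - S)) \<noteq> 0" by (rule nth_fls_subdegree_nonzero)
    then have deg: "int N < fls_subdegree (T - S)"
      using T[of "fls_subdegree (T - S)"] by (metis diff_self fls_minus_nth not_le)
    have "dist T S = (1 / 2) ^ nat (fls_subdegree (T - S))"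
      using False deg by (simp add: dist_fls_def power_one_over inverse_eq_divide)
    also have "\<dots> \<le> (1 / 2) ^ N"
      using deg by (intro power_decreasing) auto
    finally show ?thesis using N by simp
  qed (use assms in simp)
  then show thesis using that by blast
qed

definition weight_series :: "'z set \<Rightarrow> ('z \<Rightarrow> int) \<Rightarrow> ('z \<Rightarrow> 'a::ab_group_add) \<Rightarrow> 'a fls" where
  "weight_series Z \<omega> c = Abs_fls (\<lambda>k. \<Sum>z | z \<in> Z \<and> \<omega> z = k. c z)"

lemma weight_series_nth:
  assumes "\<And>k. finite {z \<in> Z. \<omega> z \<le> k}"
  shows "fls_nth (weight_series Z \<omega> c) k = (\<Sum>z | z \<in> Z \<and> \<omega> z = k. c z)"
proof -
  \<comment> \<open>The minimum of the finitely many nonpositive weights. If there are none the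
    claim is vacuous, and \<open>min N 0\<close> below still bounds the support.\<close>
  obtain N where N: "\<And>z. z \<in> Z \<Longrightarrow> \<omega> z \<le> 0 \<Longrightarrow> N \<le> \<omega> z"
  proof
    fix z assume "z \<in> Z" "\<omega> z \<le> 0"
    then show "Min (\<omega> ` {z \<in> Z. \<omega> z \<le> 0}) \<le> \<omega> z"
      using assms[of 0] by (intro Min_le) auto
  qed
  have "(\<Sum>z | z \<in> Z \<and> \<omega> z = j. c z) = 0" if "j < min N 0" for j
  proof -
    have "{z. z \<in> Z \<and> \<omega> z = j} = {}" using N that by force
    then show ?thesis by (simp only: sum.empty)
  qed
  then show ?thesis
    unfolding weight_series_def by (intro nth_Abs_fls_lower_bound[of "min N 0"]) blast
qed

text \<open>Summation over the fibres of \<open>g\<close>: a finite set containing the images of all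
  \<open>z\<close> of weight at most \<open>K\<close> already yields the final coefficients up to
  degree \<open>K\<close>. Convergence and value come together.\<close>

lemma has_sum_weight_series:
  fixes f :: "'x \<Rightarrow> 'a::ab_group_add fls"
  assumes fin: "\<And>k. finite {z \<in> Z. \<omega> z \<le> k}"
    and g: "\<And>z. z \<in> Z \<Longrightarrow> g z \<in> X"
    and f: "\<And>x k. x \<in> X \<Longrightarrow> fls_nth (f x) k = (\<Sum>z | z \<in> Z \<and> g z = x \<and> \<omega> z = k. c z)"
  shows "(f has_sum weight_series Z \<omega> c) X"
  unfolding has_sum_def tendsto_iff
proof (intro allI impI)
  fix \<epsilon> :: real assume "0 < \<epsilon>"
  then obtain K where K: "\<And>T. (\<And>j. j \<le> K \<Longrightarrow> fls_nth T j = fls_nth (weight_series Z \<omega> c) j)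
      \<Longrightarrow> dist T (weight_series Z \<omega> c) < \<epsilon>"
    using dist_fls_small by blast
  have "dist (sum f Y) (weight_series Z \<omega> c) < \<epsilon>"
    if Y: "finite Y" "g ` {z \<in> Z. \<omega> z \<le> K} \<subseteq> Y" "Y \<subseteq> X" for Y
  proof (rule K)
    fix j assume j: "j \<le> K"
    have fin_j: "finite {z. z \<in> Z \<and> \<omega> z = j}"
      using fin[of j] by (rule rev_finite_subset) auto
    have "fls_nth (sum f Y) j = (\<Sum>x\<in>Y. fls_nth (f x) j)"
      using Y(1) by (induction Y) auto
    also have "\<dots> = (\<Sum>x\<in>Y. \<Sum>z | z \<in> {z. z \<in> Z \<and> \<omega> z = j} \<and> g z = x. c z)"
      using Y(3) by (intro sum.cong refl) (auto simp: f intro!: sum.cong)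
    also have "\<dots> = (\<Sum>z | z \<in> Z \<and> \<omega> z = j. c z)"
      by (rule sum.group[OF fin_j Y(1)]) (use Y(2) j in auto)
    finally show "fls_nth (sum f Y) j = fls_nth (weight_series Z \<omega> c) j"
      by (simp add: weight_series_nth[OF fin])
  qed
  then show "\<forall>\<^sub>F Y in finite_subsets_at_top X. dist (sum f Y) (weight_series Z \<omega> c) < \<epsilon>"
    unfolding eventually_finite_subsets_at_top
    by (intro exI[of _ "g ` {z \<in> Z. \<omega> z \<le> K}"]) (use fin g in auto)
qed

text \<open>Transitivity reduces sortedness to neighbours, where \<open>lt_L\<close> demands a weak
  increase of the index that is strict unless the letter drops.\<close>

lemma biwords_L_iff_compatible:
  "z \<in> biwords_L A \<longleftrightarrow> set (map snd z) \<subseteq> A \<and> map fst z \<in> compatible (map snd z)"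
proof -
  have "sorted_wrt lt_L z \<longleftrightarrow> sorted (map fst z) \<and>
      (\<forall>j. Suc j < length z \<longrightarrow> letter_le (snd (z ! j)) (snd (z ! Suc j)) \<longrightarrow> fst (z ! j) < fst (z ! Suc j))"
  proof -
    have "lt_L p q \<longleftrightarrow> fst p \<le> fst q \<and> (letter_le (snd p) (snd q) \<longrightarrow> fst p < fst q)" for p q
      by (auto simp: lt_L_def letter_le_def)
    then show ?thesis
      unfolding sorted_wrt_iff_nth_Suc_transp[OF transp_lt(1)] sorted_iff_nth_Suc by auto
  qed
  moreover have "set z \<subseteq> dom_L A \<longleftrightarrow> set (map snd z) \<subseteq> A \<and>
      (\<forall>j < length z. 0 < fst (z ! j) \<longrightarrow> fst (z ! j) \<le> val (snd (z ! j)))"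
  proof -
    have "set z \<subseteq> dom_L A \<longleftrightarrow> set (map snd z) \<subseteq> A \<and> (\<forall>p\<in>set z. 0 < fst p \<longrightarrow> fst p \<le> val (snd p))"
      by (auto simp: dom_L_def)
    then show ?thesis
      unfolding all_set_conv_all_nth[of z "\<lambda>p. 0 < fst p \<longrightarrow> fst p \<le> val (snd p)"] .
  qed
  ultimately show ?thesis
    unfolding biwords_L_def compatible_def by (auto cong: conj_cong)
qed

lemma prod_mset_qvar: "(\<Prod>i\<in>#M. qvar powi (i - 1)) = fls_monom (\<Sum>i\<in>#M. 1 - i) 1"
  by (induction M) (simp_all add: qvar_conv_monom fls_monom_mult)

text \<open>A monomial specializes to a single power of \<open>X\<close>, which is the common weight
  of all biwords whose indices form \<open>M\<close>.\<close>

lemma specialization_term_nth: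
  assumes "\<And>a. a \<in> H \<Longrightarrow> set a \<subseteq> A"
  shows "fls_nth (specialization_term (grothendieck H l) (\<lambda>i. qvar powi (i - 1)) M) k
    = (\<Sum>z | z \<in> {z \<in> biwords_L A. map snd z \<in> H} \<and> mset (map fst z) = M \<and> sum_list (map wt_L z) = k.
        to_fract (\<beta> ^ (length z - l)))"
proof -
  have wt: "sum_list (map wt_L z) = (\<Sum>i\<in>#mset (map fst z). 1 - i)" for z
    by (induction z) (auto simp: wt_L_def)
  have coeff: "grothendieck H l M = (\<Sum>z | z \<in> {z \<in> biwords_L A. map snd z \<in> H} \<and> mset (map fst z) = M. \<beta> ^ (length z - l))"
    unfolding grothendieck_def
  proof (rule sum.reindex_bij_witness[of _ "\<lambda>z. (map snd z, map fst z)" "\<lambda>(a, s). zip s a"])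
    fix p assume "p \<in> {(a, s). a \<in> H \<and> s \<in> compatible a \<and> mset s = M}"
    then obtain a s where p: "p = (a, s)" "a \<in> H" "s \<in> compatible a" "mset s = M" by auto
    then have len: "length s = length a" by (simp add: compatible_def)
    then have maps: "map snd (zip s a) = a" "map fst (zip s a) = s" by simp_all
    show "(map snd (case p of (a, s) \<Rightarrow> zip s a), map fst (case p of (a, s) \<Rightarrow> zip s a)) = p"
      using p maps by simp
    show "(case p of (a, s) \<Rightarrow> zip s a) \<in> {z. z \<in> {z \<in> biwords_L A. map snd z \<in> H} \<and> mset (map fst z) = M}"
      using p maps assms by (simp add: biwords_L_iff_compatible del: set_map mset_map)
    show "\<beta> ^ (length (case p of (a, s) \<Rightarrow> zip s a) - l) = (case p of (a, s) \<Rightarrow> \<beta> ^ (length s - l))"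
      using p len by simp
  next
    fix z assume "z \<in> {z. z \<in> {z \<in> biwords_L A. map snd z \<in> H} \<and> mset (map fst z) = M}"
    then show "(map snd z, map fst z) \<in> {(a, s). a \<in> H \<and> s \<in> compatible a \<and> mset s = M}"
      by (simp add: biwords_L_iff_compatible del: set_map mset_map)
    show "(case (map snd z, map fst z) of (a, s) \<Rightarrow> zip s a) = z"
      by (simp add: zip_map_fst_snd)
  qed
  have "fls_nth (specialization_term (grothendieck H l) (\<lambda>i. qvar powi (i - 1)) M) k
      = (if k = (\<Sum>i\<in>#M. 1 - i) then to_fract (grothendieck H l M) else 0)"
    unfolding specialization_term_def prod_mset_qvar coef_def fls_mult_const_nth by simp
  also have "\<dots> = (\<Sum>z | z \<in> {z \<in> biwords_L A. map snd z \<in> H} \<and> mset (map fst z) = M \<and> sum_list (map wt_L z) = k.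
        to_fract (\<beta> ^ (length z - l)))"
  proof (cases "k = (\<Sum>i\<in>#M. 1 - i)")
    case True
    then show ?thesis
      unfolding coeff wt by (simp add: to_fract_sum del: mset_map cong: conj_cong)
  next
    case False
    then have "{z. z \<in> {z \<in> biwords_L A. map snd z \<in> H} \<and> mset (map fst z) = M \<and> sum_list (map wt_L z) = k} = {}"
      unfolding wt by auto
    then show ?thesis using False by (simp only: sum.empty if_False)
  qed
  finally show ?thesis .
qed

context id_coxeter_algebra
begin

text \<open>Both sides are weight series of biwords, the left grouped by the multiset of indices and
  the right by the word. They agree coefficientwise by \<open>hecke_biword_sums_eq\<close>.\<close>

theorem principal_specialization:
  assumes A: "alphabet_B n \<subseteq> A" "A \<subseteq> alphabet_C n" and n: "n \<ge> 1" and w: "w \<in> W_BC n"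
  defines "H \<equiv> hecke_words A smul n \<pi> w" and "l \<equiv> length_BC n w"
  shows "specializable (grothendieck H l) (\<lambda>i. qvar powi (i - 1))"
    and "((\<lambda>a. coef (\<beta> ^ (length a - l)) / (\<Prod>i = 1..length a. (qvar ^ i - 1))
            * qvar powi (Sigma_BC a + int (comaj_BC a)))
          has_sum specialize (grothendieck H l) (\<lambda>i. qvar powi (i - 1))) H"
proof -
  let ?F = "specialization_term (grothendieck H l) (\<lambda>i. qvar powi (i - 1))"
  let ?L = "{z \<in> biwords_L A. map snd z \<in> H}" and ?R = "{z \<in> biwords_R A. map snd z \<in> H}"
  let ?\<omega>L = "\<lambda>z. sum_list (map wt_L z)" and ?\<omega>R = "\<lambda>z. sum_list (map wt_R z)"
  let ?c = "\<lambda>z. to_fract (\<beta> ^ (length z - l))"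
  have HA: "set a \<subseteq> A" if "a \<in> H" for a
    using that by (simp add: H_def hecke_words_def)
  have fin_L: "finite {z \<in> ?L. ?\<omega>L z \<le> k}" for k
    using finite_biwords(1)[OF A(2), of k] by (rule rev_finite_subset) auto
  have fin_R: "finite {z \<in> ?R. ?\<omega>R z \<le> k}" for k
    using finite_biwords(2)[OF A(2), of k] by (rule rev_finite_subset) auto
  have L: "(?F has_sum weight_series ?L ?\<omega>L ?c) UNIV"
    by (rule has_sum_weight_series[OF fin_L, where g = "\<lambda>z. mset (map fst z)"])
      (simp, rule specialization_term_nth[OF HA])
  have R: "((\<lambda>a. coef (\<beta> ^ (length a - l)) / (\<Prod>i = 1..length a. (qvar ^ i - 1))
            * qvar powi (Sigma_BC a + int (comaj_BC a))) has_sum weight_series ?R ?\<omega>R ?c) H"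
  proof (rule has_sum_weight_series[OF fin_R, where g = "map snd"])
    fix a k assume a: "a \<in> H"
    show "fls_nth (coef (\<beta> ^ (length a - l)) / (\<Prod>i = 1..length a. (qvar ^ i - 1))
            * qvar powi (Sigma_BC a + int (comaj_BC a))) k
        = (\<Sum>z | z \<in> ?R \<and> map snd z = a \<and> ?\<omega>R z = k. ?c z)"
      unfolding nth_word_term[OF HA[OF a]] using a by (intro sum.cong) auto
  qed simp
  have "weight_series ?L ?\<omega>L ?c = weight_series ?R ?\<omega>R ?c"
  proof (rule fls_eqI)
    fix k
    have "(\<Sum>z | z \<in> ?L \<and> ?\<omega>L z = k. ?c z) = (\<Sum>z | z \<in> ?R \<and> ?\<omega>R z = k. ?c z)"
      using arg_cong[OF hecke_biword_sums_eq[OF A n w, of k], of to_fract]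
      by (simp add: to_fract_sum H_def l_def conj_assoc)
    then show "fls_nth (weight_series ?L ?\<omega>L ?c) k = fls_nth (weight_series ?R ?\<omega>R ?c) k"
      unfolding weight_series_nth[OF fin_L] weight_series_nth[OF fin_R] .
  qed
  moreover have "specialize (grothendieck H l) (\<lambda>i. qvar powi (i - 1)) = weight_series ?L ?\<omega>L ?c"
    unfolding specialize_def by (rule infsumI[OF L])
  ultimately show "((\<lambda>a. coef (\<beta> ^ (length a - l)) / (\<Prod>i = 1..length a. (qvar ^ i - 1))
            * qvar powi (Sigma_BC a + int (comaj_BC a)))
          has_sum specialize (grothendieck H l) (\<lambda>i. qvar powi (i - 1))) H"
    using R by simp
  show "specializable (grothendieck H l) (\<lambda>i. qvar powi (i - 1))"
    unfolding specializable_def summable_on_def using L by blast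
qed

end

theorem theorem3p6:
  fixes n :: nat
    and smul :: "int poly \<Rightarrow> 'h::ring_1 \<Rightarrow> 'h"
    and \<pi> :: "(int \<Rightarrow> int) \<Rightarrow> 'h"
    and w :: "int \<Rightarrow> int"
  assumes "n \<ge> 1"
    and "id_coxeter_algebra smul n \<pi>"
    and "w \<in> W_BC n"
  shows "(specializable (grothendieck_B smul n \<pi> w) (\<lambda>i. qvar powi (i - 1))
        \<and> ((\<lambda>a. coef (\<beta> ^ (length a - length_BC n w)) / (\<Prod>i = 1..length a. (qvar ^ i - 1))
                  * qvar powi (Sigma_BC a + int (comaj_BC a)))
            has_sum specialize (grothendieck_B smul n \<pi> w) (\<lambda>i. qvar powi (i - 1)))
            (hecke_B smul n \<pi> w))
      \<and> (specializable (grothendieck_C smul n \<pi> w) (\<lambda>i. qvar powi (i - 1))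
        \<and> ((\<lambda>a. coef (\<beta> ^ (length a - length_BC n w)) / (\<Prod>i = 1..length a. (qvar ^ i - 1))
                  * qvar powi (Sigma_BC a + int (comaj_BC a)))
            has_sum specialize (grothendieck_C smul n \<pi> w) (\<lambda>i. qvar powi (i - 1)))
            (hecke_C smul n \<pi> w))"
proof -
  interpret id_coxeter_algebra smul n \<pi> by (rule assms(2))
  show ?thesis
    unfolding grothendieck_B_def grothendieck_C_def hecke_B_def hecke_C_def
    using principal_specialization[of "alphabet_B n" w] principal_specialization[of "alphabet_C n" w] assms(1,3)
    by (simp add: alphabet_B_def)
qed

end
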